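(* Let $b:\mathbb{R}\to\mathbb{R}$ be a continuous function with $b(x)=0$ for $x\le 0$, and $b\in C^2$, $b'(x)\ge 0$ for $x>0$. Put $H(x)=\int_0^x \frac{b'(t)}{\sqrt{1+b'(t)^2}}\,dt$ and suppose that for $x>0$ $$b'(x)\ge 0,\qquad b''(x)H(x)>-b'(x)^2\sqrt{1+b'(x)^2}.$$ Let $\Omega=\{x>0,\ y>b(x)\}$, $W=\{x\ge 0,\ y=b(x)\}$, let $E_0>1/2$ be a constant, and let $\gamma=1$. Then Problem 1 (limiting hypersonic flow past the infinite ramp $W$, see the context) has a Radon measure solution $(\varrho,u,v,E)$, whose density contains a weighted Dirac measure supported on $W$, given by $$\varrho=\mathsf{I}_{\Omega}\mathcal{L}^2+\frac{b(x)^2}{H(x)}\,\delta_W,$$ $$u=\mathsf{I}_\Omega+\frac{H(x)}{b(x)\sqrt{1+b'(x)^2}}\,\mathsf{I}_W,\qquad v=\frac{b'(x)H(x)}{b(x)\sqrt{1+b'(x)^2}}\,\mathsf{I}_W,\qquad E=E_0\mathsf{I}_\Omega+E_0\mathsf{I}_W .$$ In particular, for this solution the function $w_p$ on $W$ is $$w_p(x)=\frac{b''(x)H(x)+b'(x)^2\sqrt{1+b'(x)^2}}{(1+b'(x)^2)^{3/2}}.$$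
   Context: Notation. $\mathsf{I}_A$ is the characteristic function of $A\subset\mathbb{R}^2$, $\mathcal{L}^2$ is Lebesgue measure on $\mathbb{R}^2$, and $\langle m,\phi\rangle=\int\phi\,dm$ for a Radon measure $m$. For a Lipschitz curve $L=\{(x(t),y(t)):t\in[0,T)\}$ and a weight $w_L\in L^1_{loc}(0,T)$, $w_L\delta_L$ is the measure $\langle w_L\delta_L,\phi\rangle=\int_0^T w_L(t)\phi(x(t),y(t))\sqrt{x'(t)^2+y'(t)^2}\,dt$. For $W$ the parameter is $x$. $C_0^1(\mathbb{R}^2)$ denotes continuously differentiable functions with compact support. Euler system. The two-dimensional steady compressible Euler equations are $$\partial_x(\rho u)+\partial_y(\rho v)=0,\quad \partial_x(\rho u^2+p)+\partial_y(\rho uv)=0,\quad \partial_x(\rho uv)+\partial_y(\rho v^2+p)=0,\quad \partial_x(\rho uE)+\partial_y(\rho vE)=0,$$ with state function $p=\frac{\gamma-1}{\gamma}\rho\,(E-\frac12(u^2+v^2))$. So $p=0$ if $\gamma=1$. Problem 1. Solve this system in $\Omega$ with $\gamma=1$, slip condition $v=b'(x)u$ on $W$, and data $(\rho_0,u_0,v_0,E_0)=(1,1,0,E_0)$ (hence $p_0=0$) on $\{x=0,\ y>0\}$. Measure solution of Problem 1. $(\varrho,u,v,E)$ is a (Radon) measure solution if there are Radon measures $m^i,n^i$ ($i=0,1,2,3$) and $\wp$ on $\overline\Omega$ and a nonnegative function $w_p\in L^1_{loc}([0,\infty))$ such that: (i) For all $\phi\in C_0^1(\mathbb{R}^2)$,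 $$\langle m^0,\partial_x\phi\rangle+\langle n^0,\partial_y\phi\rangle+\int_0^\infty\rho_0u_0\phi(0,y)\,dy=0,$$ $$\langle m^1,\partial_x\phi\rangle+\langle n^1,\partial_y\phi\rangle+\langle\wp,\partial_x\phi\rangle+\langle w_pn_1\delta_W,\phi\rangle+\int_0^\infty(\rho_0u_0^2+p_0)\phi(0,y)\,dy=0,$$ $$\langle m^2,\partial_x\phi\rangle+\langle n^2,\partial_y\phi\rangle+\langle\wp,\partial_y\phi\rangle+\langle w_pn_2\delta_W,\phi\rangle+\int_0^\infty\rho_0u_0v_0\phi(0,y)\,dy=0,$$ $$\langle m^3,\partial_x\phi\rangle+\langle n^3,\partial_y\phi\rangle+\int_0^\infty\rho_0u_0E_0\phi(0,y)\,dy=0,$$ where $(n_1,n_2)=(-b'(x),1)/\sqrt{1+b'(x)^2}$ is the unit normal on $W$ pointing into $\Omega$. (ii) $\varrho$ is a nonnegative Radon measure, $\wp\ll\varrho$, $(m^0,n^0)\ll\varrho$, $(m^k,n^k)\ll(m^0,n^0)$ for $k=1,2,3$, and the Radon–Nikodym derivatives satisfy $\varrho$-a.e. $u=\frac{dm^0}{d\varrho}$, $v=\frac{dn^0}{d\varrho}$, $u=\frac{dm^1}{dm^0}=\frac{dn^1}{dn^0}$, $v=\frac{dm^2}{dm^0}=\frac{dn^2}{dn^0}$, and $E=\frac{dm^3}{dm^0}=\frac{dn^3}{dn^0}$. On null sets of $\varrho$ one sets $u=v=E=0$. (iii) If $\varrho\ll\mathcal{L}^2$ and $\wp\ll\mathcal{L}^2$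 in a set $A$, with densities $\rho$ and $p$, then the state function holds $\mathcal{L}^2$-a.e. in $A$, and the classical entropy conditions hold across discontinuities of $(\rho,u,v,E)$ in $A$.
   Formalization: The ramp W is additionally assumed to be a Lipschitz curve (b Lipschitz on every [0,T]), as the definition of δ_W requires; without it, e.g. for b ~ x^{1/4} near 0, the density ϱ is not locally finite and so is not a Radon measure. *)

theory Defs
  imports "HOL-Analysis.Analysis"
begin

section \<open>Real-valued Radon measures on the plane\<close>

type_synonym plane = "real \<times> real"

definition radon_measure :: "plane measure \<Rightarrow> bool" where
  "radon_measure M \<longleftrightarrow> sets M = sets borel \<and> (\<forall>K. compact K \<longrightarrow> emeasure M K < \<infinity>)"

text \<open>
  The components of the momentum may be negative, so the \<open>m\<^sup>i\<close>, \<open>n\<^sup>i\<close> are signed measures.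
  A signed Radon measure need not have a value on unbounded sets; it is represented by its Jordan
  decomposition, a pair of mutually singular nonnegative Radon measures.
\<close>

type_synonym signed_measure = "plane measure \<times> plane measure"

definition signed_radon_measure :: "signed_measure \<Rightarrow> bool" where
  "signed_radon_measure m \<longleftrightarrow> radon_measure (fst m) \<and> radon_measure (snd m) \<and>
     (\<exists>P \<in> sets borel. emeasure (fst m) (- P) = 0 \<and> emeasure (snd m) P = 0)"

definition signed_of :: "plane measure \<Rightarrow> signed_measure" where
  "signed_of M = (M, null_measure borel)"

definition concentrated_on :: "plane set \<Rightarrow> signed_measure \<Rightarrow> bool" where
  "concentrated_on S m \<longleftrightarrow> emeasure (fst m) (- S) = 0 \<and> emeasure (snd m) (- S) = 0"

definition pairing :: "signed_measure \<Rightarrow> (plane \<Rightarrow> real) \<Rightarrow> real" where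
  "pairing m \<phi> = (\<integral>z. \<phi> z \<partial>fst m) - (\<integral>z. \<phi> z \<partial>snd m)"

text \<open>A set is null for the total variation of \<open>m\<close> iff it is null for both parts of \<open>m\<close>.\<close>

definition abs_cont :: "signed_measure \<Rightarrow> signed_measure \<Rightarrow> bool" (infix "\<lless>" 50) where
  "\<nu> \<lless> \<mu> \<longleftrightarrow> null_sets (fst \<mu>) \<inter> null_sets (snd \<mu>) \<subseteq> null_sets (fst \<nu>) \<inter> null_sets (snd \<nu>)"

text \<open>
  \<open>f\<close> is a version of the Radon--Nikodym derivative \<open>d\<nu>/d\<mu>\<close> in the set \<open>A\<close>:
  \<open>\<nu>(B) = \<integral>\<^sub>B f d\<mu>\<close> for the bounded Borel sets \<open>B \<subseteq> A\<close>.
\<close>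

definition is_RN_deriv_on :: "plane set \<Rightarrow> (plane \<Rightarrow> real) \<Rightarrow> signed_measure \<Rightarrow> signed_measure \<Rightarrow> bool" where
  "is_RN_deriv_on A f \<nu> \<mu> \<longleftrightarrow>
     (\<forall>B \<in> sets borel. bounded B \<and> B \<subseteq> A \<longrightarrow>
        set_integrable (fst \<mu>) B f \<and> set_integrable (snd \<mu>) B f \<and>
        measure (fst \<nu>) B - measure (snd \<nu>) B = (LINT z:B|fst \<mu>. f z) - (LINT z:B|snd \<mu>. f z))"

abbreviation is_RN_deriv :: "(plane \<Rightarrow> real) \<Rightarrow> signed_measure \<Rightarrow> signed_measure \<Rightarrow> bool" where
  "is_RN_deriv \<equiv> is_RN_deriv_on UNIV"

definition add_measure :: "plane measure \<Rightarrow> plane measure \<Rightarrow> plane measure" where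
  "add_measure M N = measure_of UNIV (sets borel) (\<lambda>A. emeasure M A + emeasure N A)"

lemma emeasure_add_measure:
  assumes "sets M = sets borel" "sets N = sets borel" "A \<in> sets borel"
  shows "emeasure (add_measure M N) A = emeasure M A + emeasure N A"
  unfolding add_measure_def
proof (rule emeasure_measure_of_sigma)
  show "sigma_algebra UNIV (sets (borel :: plane measure))"
    using sets.sigma_algebra_axioms[of "borel :: plane measure"] by simp
  show "positive (sets borel) (\<lambda>A. emeasure M A + emeasure N A)"
    by (simp add: positive_def)
  show "countably_additive (sets borel) (\<lambda>A. emeasure M A + emeasure N A)"
    unfolding countably_additive_def
  proof (intro allI impI)
    fix B :: "nat \<Rightarrow> plane set"
    assume B: "range B \<subseteq> sets borel" "disjoint_family B"
    have "(\<Sum>i. emeasure M (B i) + emeasure N (B i)) =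
        (\<Sum>i. emeasure M (B i)) + (\<Sum>i. emeasure N (B i))"
      by (intro suminf_add[symmetric]) auto
    then show "(\<Sum>i. emeasure M (B i) + emeasure N (B i)) =
        emeasure M (\<Union>i. B i) + emeasure N (\<Union>i. B i)"
      using B assms(1,2) by (simp add: suminf_emeasure)
  qed
qed (use assms in simp)


section \<open>Weighted Dirac measures on curves\<close>

definition param_domain :: "ereal \<Rightarrow> real set" where
  "param_domain T = {t. 0 \<le> t \<and> ereal t < T}"

definition curve_speed :: "(real \<Rightarrow> real) \<Rightarrow> (real \<Rightarrow> real) \<Rightarrow> real \<Rightarrow> real" where
  "curve_speed x y t = sqrt ((deriv x t)\<^sup>2 + (deriv y t)\<^sup>2)"

text \<open>The pairing \<open>\<langle>w\<delta>\<^sub>L, \<phi>\<rangle>\<close>, for weights of any sign.\<close>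

definition curve_pairing ::
    "(real \<Rightarrow> real) \<Rightarrow> (real \<Rightarrow> real) \<Rightarrow> ereal \<Rightarrow> (real \<Rightarrow> real) \<Rightarrow> (plane \<Rightarrow> real) \<Rightarrow> real" where
  "curve_pairing x y T w \<phi> =
     (LINT t:param_domain T|lborel. w t * \<phi> (x t, y t) * curve_speed x y t)"

text \<open>The measure \<open>w\<delta>\<^sub>L\<close>, for nonnegative weights \<open>w\<close> only.\<close>

definition curve_dirac ::
    "(real \<Rightarrow> real) \<Rightarrow> (real \<Rightarrow> real) \<Rightarrow> ereal \<Rightarrow> (real \<Rightarrow> real) \<Rightarrow> plane measure" where
  "curve_dirac x y T w =
     distr (density lborel
       (\<lambda>t. ennreal (indicator (param_domain T) t * (w t * curve_speed x y t))))
       borel (\<lambda>t. (x t, y t))"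

lemma integral_curve_dirac:
  assumes "\<And>t. t \<in> param_domain T \<Longrightarrow> 0 \<le> w t"
    and "set_borel_measurable lborel (param_domain T) (\<lambda>t. w t * curve_speed x y t)"
    and "x \<in> borel_measurable borel" "y \<in> borel_measurable borel" "\<phi> \<in> borel_measurable borel"
  shows "(\<integral>z. \<phi> z \<partial>curve_dirac x y T w) = curve_pairing x y T w \<phi>"
proof -
  let ?g = "\<lambda>t. indicator (param_domain T) t * (w t * curve_speed x y t)"
  have g: "?g \<in> borel_measurable lborel"
    using assms(2) by (simp add: set_borel_measurable_def)
  have xy: "(\<lambda>t. (x t, y t)) \<in> measurable lborel borel"
    using assms(3,4) by (simp add: borel_measurable_Pair)
  have nonneg: "0 \<le> ?g t" for t
    using assms(1) by (auto simp: indicator_def curve_speed_def)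
  have \<phi>xy: "(\<lambda>t. \<phi> (x t, y t)) \<in> borel_measurable lborel"
    using measurable_compose[OF xy assms(5)] by simp
  have "(\<integral>z. \<phi> z \<partial>curve_dirac x y T w) =
      (\<integral>t. \<phi> (x t, y t) \<partial>density lborel (\<lambda>t. ennreal (?g t)))"
    unfolding curve_dirac_def using xy assms(5) by (intro integral_distr) auto
  also have "\<dots> = (\<integral>t. ?g t *\<^sub>R \<phi> (x t, y t) \<partial>lborel)"
    using g nonneg \<phi>xy by (intro integral_density) auto
  also have "\<dots> = curve_pairing x y T w \<phi>"
    by (simp add: curve_pairing_def set_lebesgue_integral_def mult_ac)
  finally show ?thesis .
qed


section \<open>Test functions\<close>

definition dx :: "(plane \<Rightarrow> real) \<Rightarrow> plane \<Rightarrow> real" where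
  "dx \<phi> z = deriv (\<lambda>s. \<phi> (s, snd z)) (fst z)"

definition dy :: "(plane \<Rightarrow> real) \<Rightarrow> plane \<Rightarrow> real" where
  "dy \<phi> z = deriv (\<lambda>s. \<phi> (fst z, s)) (snd z)"

definition C1_compact_support :: "(plane \<Rightarrow> real) \<Rightarrow> bool" where
  "C1_compact_support \<phi> \<longleftrightarrow>
     (\<forall>z. \<phi> differentiable at z) \<and> continuous_on UNIV (dx \<phi>) \<and> continuous_on UNIV (dy \<phi>) \<and>
     compact (closure {z. \<phi> z \<noteq> 0})"


section \<open>The ramp\<close>

text \<open>Only meaningful for open \<open>S\<close>.\<close>

definition C2_on :: "real set \<Rightarrow> (real \<Rightarrow> real) \<Rightarrow> bool" where
  "C2_on S f \<longleftrightarrow> (\<forall>x \<in> S. f differentiable at x) \<and> (\<forall>x \<in> S. deriv f differentiable at x) \<and>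
     continuous_on S (deriv (deriv f))"

definition ramp_domain :: "(real \<Rightarrow> real) \<Rightarrow> plane set" where
  "ramp_domain b = {(x, y). x > 0 \<and> y > b x}"

definition ramp_wall :: "(real \<Rightarrow> real) \<Rightarrow> plane set" where
  "ramp_wall b = {(x, y). x \<ge> 0 \<and> y = b x}"

definition ramp_H :: "(real \<Rightarrow> real) \<Rightarrow> real \<Rightarrow> real" where
  "ramp_H b x = integral {0..x} (\<lambda>t. deriv b t / sqrt (1 + (deriv b t)\<^sup>2))"

text \<open>The unit normal on the wall pointing into the domain.\<close>

definition normal1 :: "(real \<Rightarrow> real) \<Rightarrow> real \<Rightarrow> real" where
  "normal1 b x = - deriv b x / sqrt (1 + (deriv b x)\<^sup>2)"

definition normal2 :: "(real \<Rightarrow> real) \<Rightarrow> real \<Rightarrow> real" where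
  "normal2 b x = 1 / sqrt (1 + (deriv b x)\<^sup>2)"

abbreviation wall_pairing :: "(real \<Rightarrow> real) \<Rightarrow> (real \<Rightarrow> real) \<Rightarrow> (plane \<Rightarrow> real) \<Rightarrow> real" where
  "wall_pairing b \<equiv> curve_pairing (\<lambda>t. t) b \<infinity>"

abbreviation wall_dirac :: "(real \<Rightarrow> real) \<Rightarrow> (real \<Rightarrow> real) \<Rightarrow> plane measure" where
  "wall_dirac b \<equiv> curve_dirac (\<lambda>t. t) b \<infinity>"


section \<open>State function and entropy condition\<close>

definition state_pressure :: "real \<Rightarrow> real \<Rightarrow> real \<Rightarrow> real \<Rightarrow> real \<Rightarrow> real" where
  "state_pressure \<gamma> \<rho> u v E = (\<gamma> - 1) / \<gamma> * \<rho> * (E - (u\<^sup>2 + v\<^sup>2) / 2)"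

definition half_ball :: "plane \<Rightarrow> plane \<Rightarrow> real \<Rightarrow> plane set" where
  "half_ball z \<nu> r = {w \<in> ball z r. (w - z) \<bullet> \<nu> > 0}"

text \<open>
  \<open>c\<close> is the approximate one-sided limit of \<open>f\<close> at \<open>z\<close> from the side into which \<open>\<nu>\<close> points. It does
  not depend on the representative of \<open>f\<close> modulo Lebesgue null sets, which matters for densities.
\<close>

definition one_sided_limit :: "(plane \<Rightarrow> real) \<Rightarrow> plane \<Rightarrow> plane \<Rightarrow> real \<Rightarrow> bool" where
  "one_sided_limit f z \<nu> c \<longleftrightarrow>
     ((\<lambda>r. (\<integral>\<^sup>+w\<in>half_ball z \<nu> r. ennreal \<bar>f w - c\<bar> \<partial>lborel) / ennreal (r\<^sup>2)) \<longlongrightarrow> 0) (at_right 0)"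

text \<open>
  The classical entropy condition for steady compressible flow: shocks are compressive, that is,
  the density increases across a shock in the direction of the flow. Here \<open>z\<close> is a jump point in the
  interior of \<open>A\<close> with unit normal \<open>\<nu>\<close> to the discontinuity and \<open>(\<rho>\<^sub>1, u\<^sub>1, v\<^sub>1, E\<^sub>1)\<close>,
  \<open>(\<rho>\<^sub>2, u\<^sub>2, v\<^sub>2, E\<^sub>2)\<close> are the limits from the sides of \<open>- \<nu>\<close> and \<open>\<nu>\<close>. The discontinuity is a
  shock if the flow crosses it; contact discontinuities (no mass flux) are not restricted.
  Replacing \<open>\<nu>\<close> by \<open>- \<nu>\<close> covers flow in the opposite direction.
\<close>

definition entropy_condition_on ::
    "plane set \<Rightarrow> (plane \<Rightarrow> real) \<Rightarrow> (plane \<Rightarrow> real) \<Rightarrow> (plane \<Rightarrow> real) \<Rightarrow> (plane \<Rightarrow> real) \<Rightarrow> bool" where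
  "entropy_condition_on A \<rho> u v E \<longleftrightarrow>
     (\<forall>z \<in> interior A. \<forall>\<nu> \<rho>\<^sub>1 u\<^sub>1 v\<^sub>1 E\<^sub>1 \<rho>\<^sub>2 u\<^sub>2 v\<^sub>2 E\<^sub>2.
        norm \<nu> = 1 \<and>
        one_sided_limit \<rho> z (- \<nu>) \<rho>\<^sub>1 \<and> one_sided_limit \<rho> z \<nu> \<rho>\<^sub>2 \<and>
        one_sided_limit u z (- \<nu>) u\<^sub>1 \<and> one_sided_limit u z \<nu> u\<^sub>2 \<and>
        one_sided_limit v z (- \<nu>) v\<^sub>1 \<and> one_sided_limit v z \<nu> v\<^sub>2 \<and>
        one_sided_limit E z (- \<nu>) E\<^sub>1 \<and> one_sided_limit E z \<nu> E\<^sub>2 \<and>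
        (\<rho>\<^sub>1, u\<^sub>1, v\<^sub>1, E\<^sub>1) \<noteq> (\<rho>\<^sub>2, u\<^sub>2, v\<^sub>2, E\<^sub>2) \<and>
        \<rho>\<^sub>1 * ((u\<^sub>1, v\<^sub>1) \<bullet> \<nu>) > 0
        \<longrightarrow> \<rho>\<^sub>1 < \<rho>\<^sub>2)"


section \<open>Radon measure solutions\<close>

text \<open>The weak form of the equations, with \<open>P\<close> for the measure \<open>\<wp>\<close> and \<open>w\<close> for the weight \<open>w\<^sub>p\<close>.\<close>

definition weak_euler ::
    "(real \<Rightarrow> real) \<Rightarrow> real \<Rightarrow> real \<Rightarrow> real \<Rightarrow> real \<Rightarrow> real \<Rightarrow>
     (nat \<Rightarrow> signed_measure) \<Rightarrow> (nat \<Rightarrow> signed_measure) \<Rightarrow> signed_measure \<Rightarrow> (real \<Rightarrow> real) \<Rightarrow> bool" where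
  "weak_euler b \<rho>\<^sub>0 u\<^sub>0 v\<^sub>0 E\<^sub>0 p\<^sub>0 m n P w \<longleftrightarrow>
     (\<forall>\<phi>. C1_compact_support \<phi> \<longrightarrow>
        pairing (m 0) (dx \<phi>) + pairing (n 0) (dy \<phi>)
          + (LINT y:{0..}|lborel. \<rho>\<^sub>0 * u\<^sub>0 * \<phi> (0, y)) = 0 \<and>
        pairing (m 1) (dx \<phi>) + pairing (n 1) (dy \<phi>) + pairing P (dx \<phi>)
          + wall_pairing b (\<lambda>x. w x * normal1 b x) \<phi>
          + (LINT y:{0..}|lborel. (\<rho>\<^sub>0 * u\<^sub>0\<^sup>2 + p\<^sub>0) * \<phi> (0, y)) = 0 \<and>
        pairing (m 2) (dx \<phi>) + pairing (n 2) (dy \<phi>) + pairing P (dy \<phi>)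
          + wall_pairing b (\<lambda>x. w x * normal2 b x) \<phi>
          + (LINT y:{0..}|lborel. \<rho>\<^sub>0 * u\<^sub>0 * v\<^sub>0 * \<phi> (0, y)) = 0 \<and>
        pairing (m 3) (dx \<phi>) + pairing (n 3) (dy \<phi>)
          + (LINT y:{0..}|lborel. \<rho>\<^sub>0 * u\<^sub>0 * E\<^sub>0 * \<phi> (0, y)) = 0)"

text \<open>
  \<open>(R, u, v, E)\<close>, with \<open>R\<close> for the measure \<open>\<varrho>\<close>, is a measure solution for the ramp \<open>b\<close> with adiabatic
  exponent \<open>\<gamma>\<close> and data \<open>(\<rho>\<^sub>0, u\<^sub>0, v\<^sub>0, E\<^sub>0)\<close> on \<open>{x = 0, y > 0}\<close>, with \<open>w\<close> as its weight \<open>w\<^sub>p\<close>.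
  Since \<open>m\<^sup>0, n\<^sup>0 \<lless> \<varrho>\<close>, requiring that \<open>u\<close> be a version of \<open>dm\<^sup>1/dm\<^sup>0\<close> is the same as requiring it
  to be \<open>\<varrho>\<close>-almost everywhere equal to one. The convention \<open>u = v = E = 0\<close> on \<open>\<varrho>\<close>-null sets concerns the
  vacuum, that is, open null sets (every function would have to vanish on Lebesgue null sets otherwise).
\<close>

definition measure_solution ::
    "real \<Rightarrow> (real \<Rightarrow> real) \<Rightarrow> real \<Rightarrow> real \<Rightarrow> real \<Rightarrow> real \<Rightarrow>
     plane measure \<Rightarrow> (plane \<Rightarrow> real) \<Rightarrow> (plane \<Rightarrow> real) \<Rightarrow> (plane \<Rightarrow> real) \<Rightarrow> (real \<Rightarrow> real) \<Rightarrow> bool" where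
  "measure_solution \<gamma> b \<rho>\<^sub>0 u\<^sub>0 v\<^sub>0 E\<^sub>0 R u v E w \<longleftrightarrow>
     (\<exists>m n P.
        (\<forall>i \<in> {0, 1, 2, 3}. signed_radon_measure (m i) \<and> signed_radon_measure (n i) \<and>
           concentrated_on (closure (ramp_domain b)) (m i) \<and>
           concentrated_on (closure (ramp_domain b)) (n i)) \<and>
        signed_radon_measure P \<and> concentrated_on (closure (ramp_domain b)) P \<and>
        (\<forall>x \<ge> 0. 0 \<le> w x) \<and> (\<forall>T. set_integrable lborel {0..T} w) \<and>
        weak_euler b \<rho>\<^sub>0 u\<^sub>0 v\<^sub>0 E\<^sub>0 (state_pressure \<gamma> \<rho>\<^sub>0 u\<^sub>0 v\<^sub>0 E\<^sub>0) m n P w \<and>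
        radon_measure R \<and> concentrated_on (closure (ramp_domain b)) (signed_of R) \<and>
        P \<lless> signed_of R \<and> m 0 \<lless> signed_of R \<and> n 0 \<lless> signed_of R \<and>
        (\<forall>k \<in> {1, 2, 3}. m k \<lless> m 0 \<and> n k \<lless> n 0) \<and>
        is_RN_deriv u (m 0) (signed_of R) \<and> is_RN_deriv v (n 0) (signed_of R) \<and>
        is_RN_deriv u (m 1) (m 0) \<and> is_RN_deriv u (n 1) (n 0) \<and>
        is_RN_deriv v (m 2) (m 0) \<and> is_RN_deriv v (n 2) (n 0) \<and>
        is_RN_deriv E (m 3) (m 0) \<and> is_RN_deriv E (n 3) (n 0) \<and>
        (\<forall>N. open N \<and> emeasure R N = 0 \<longrightarrow> (\<forall>z \<in> N. u z = 0 \<and> v z = 0 \<and> E z = 0)) \<and>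
        (\<forall>A \<in> sets borel. \<forall>\<rho> p. A \<subseteq> closure (ramp_domain b) \<and>
           is_RN_deriv_on A \<rho> (signed_of R) (signed_of lborel) \<and>
           is_RN_deriv_on A p P (signed_of lborel) \<longrightarrow>
             (AE z in lborel. z \<in> A \<longrightarrow> p z = state_pressure \<gamma> (\<rho> z) (u z) (v z) (E z)) \<and>
             entropy_condition_on A \<rho> u v E))"

end

theory Submission
  imports Defs
begin

text \<open>
  The inequality on \<open>b''\<close> forces \<open>b' > 0\<close> for \<open>x > 0\<close>, whence \<open>0 < H \<le> b\<close> and \<open>u\<close>, \<open>v\<close> take values
  in \<open>[0, 1]\<close>. Take \<open>\<wp> = 0\<close> and \<open>m\<^sup>0 = u\<varrho>\<close>, \<open>n\<^sup>0 = v\<varrho>\<close>, \<open>m\<^sup>k = f m\<^sup>0\<close>, \<open>n\<^sup>k = f n\<^sup>0\<close> with \<open>f = u, v, E\<close>. On the wall,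
  parametrized by \<open>x\<close>, the densities of \<open>u\<varrho>\<close>, \<open>u\<^sup>2\<varrho>\<close>, \<open>uv\<varrho>\<close> are \<open>b\<close>, \<open>K = H/\<surd>(1 + b'\<^sup>2)\<close> and \<open>G = b'K\<close>, and
  each \<open>y\<close>-flux is \<open>b'\<close> times the \<open>x\<close>-flux. Integrating along the wall and over \<open>\<Omega>\<close>, the weak equations
  reduce to \<open>b' = b'\<close>, \<open>K' + w\<^sub>p b' = b'\<close> and \<open>G' = w\<^sub>p\<close>. All states are constant in \<open>\<Omega>\<close>, so there are
  no jumps to which the entropy condition could apply.
\<close>

section \<open>Radon measures and Radon--Nikodym derivatives\<close>

text \<open>\<open>H\<close> is the tangential momentum flux of the wall layer. Let t = (1, b')/s
  with s = sqrt (1 + b'^2). Per unit of x the layer collects mass b' and momentum (b', 0), and the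
  wall pushes only along its normal. With mass flux b and momentum flux M t, the tangential balance
  reads M' = b'/s, because t' is orthogonal to t; hence M = H. The velocity is then H t / b, and
  mass flux b = density * u * s gives the density b^2 / H. The normal balance yields w_p = b'' H /
  s^3 + b'^2 / s^2, a curvature term plus an impact term, and the hypothesis on b'' says that this
  is positive for x > 0. The obstacle is the corner x = 0, where b and H vanish,
  \<open>deriv b 0\<close> may be meaningless and b'' may blow up nearby. The Lipschitz bound keeps
  b' bounded on (0, T], so b is at most a constant times H there and b^2 / H is locally bounded. No
  bound is available for w_p; it is integrable because it is nonnegative and the derivative of a
  function continuous up to the corner.\<close>

lemma sets_add_measure [simp, measurable_cong]: "sets (add_measure M N) = sets borel"
  unfolding add_measure_def
  using sets.sigma_sets_eq[of "borel :: plane measure"] by simp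

lemma nn_integral_add_measure:
  assumes M: "sets M = sets borel" and N: "sets N = sets borel" and f: "f \<in> borel_measurable borel"
  shows "(\<integral>\<^sup>+z. f z \<partial>add_measure M N) = (\<integral>\<^sup>+z. f z \<partial>M) + (\<integral>\<^sup>+z. f z \<partial>N)"
proof -
  have sp: "space M = UNIV" "space N = UNIV" "space (add_measure M N) = UNIV"
    using sets_eq_imp_space_eq[OF M] sets_eq_imp_space_eq[OF N]
      sets_eq_imp_space_eq[OF sets_add_measure[of M N]] by simp_all
  have mb: "g \<in> borel_measurable M" "g \<in> borel_measurable N" "g \<in> borel_measurable (add_measure M N)"
    if "g \<in> borel_measurable borel" for g :: "plane \<Rightarrow> ennreal"
    using that by (simp_all add: measurable_cong_sets[OF M refl] measurable_cong_sets[OF N refl]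
        measurable_cong_sets[OF sets_add_measure refl])
  from f show ?thesis
  proof (induction rule: borel_measurable_induct)
    case (cong f g)
    then have "f = g" by auto
    with cong show ?case by simp
  next
    case (set A)
    then show ?case by (simp add: M N emeasure_add_measure)
  next
    case (mult u c)
    then show ?case by (simp add: nn_integral_cmult mb distrib_left)
  next
    case (add u v)
    then show ?case by (simp add: nn_integral_add mb algebra_simps)
  next
    case (seq U)
    have mono: "(SUP i. \<integral>\<^sup>+z. U i z \<partial>M) + (SUP i. \<integral>\<^sup>+z. U i z \<partial>N) =
        (SUP i. (\<integral>\<^sup>+z. U i z \<partial>M) + (\<integral>\<^sup>+z. U i z \<partial>N))"
      using \<open>incseq U\<close>
      by (intro ennreal_SUP_add[symmetric]) (auto simp: incseq_def le_fun_def intro!: nn_integral_mono)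
    have "(\<integral>\<^sup>+z. (SUP i. U i) z \<partial>K) = (SUP i. \<integral>\<^sup>+z. U i z \<partial>K)"
      if "\<And>i. U i \<in> borel_measurable K" for K
      unfolding SUP_apply using that seq.hyps by (intro nn_integral_monotone_convergence_SUP) auto
    then show ?case using seq mono by (simp add: mb)
  qed
qed

lemma
  fixes f :: "plane \<Rightarrow> real"
  assumes M: "sets M = sets borel" and N: "sets N = sets borel"
    and fM: "integrable M f" and fN: "integrable N f"
  shows integrable_add_measure: "integrable (add_measure M N) f"
    and integral_add_measure: "(\<integral>z. f z \<partial>add_measure M N) = (\<integral>z. f z \<partial>M) + (\<integral>z. f z \<partial>N)"
proof -
  have f: "f \<in> borel_measurable borel"
    using borel_measurable_integrable[OF fM] measurable_cong_sets[OF M refl] by blast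
  have nn: "(\<integral>\<^sup>+z. ennreal (g z) \<partial>add_measure M N) =
      (\<integral>\<^sup>+z. ennreal (g z) \<partial>M) + (\<integral>\<^sup>+z. ennreal (g z) \<partial>N)"
    if "g \<in> borel_measurable borel" for g
    using that by (intro nn_integral_add_measure M N) auto
  show I: "integrable (add_measure M N) f"
    using fM fN f nn[of "\<lambda>z. norm (f z)"] measurable_cong_sets[OF sets_add_measure refl, of M N]
    unfolding integrable_iff_bounded by auto
  \<comment> \<open>\<open>s = 1\<close> and \<open>s = -1\<close> give finiteness of the integrals
    of the positive and the negative part, the condition under which \<open>enn2real\<close> is
    additive.\<close>
  have fin: "(\<integral>\<^sup>+z. ennreal (s * f z) \<partial>K) \<noteq> \<infinity>" if "integrable K f" for s and K :: "plane measure"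
  proof -
    from that have "integrable K (\<lambda>z. s * f z)" by simp
    then show ?thesis unfolding real_integrable_def infinity_ennreal_def by blast
  qed
  show "(\<integral>z. f z \<partial>add_measure M N) = (\<integral>z. f z \<partial>M) + (\<integral>z. f z \<partial>N)"
    using fin[OF fM, of 1] fin[OF fN, of 1] fin[OF fM, of "-1"] fin[OF fN, of "-1"] f
    by (simp add: real_lebesgue_integral_def I fM fN nn enn2real_plus less_top)
qed

lemma radon_measureD:
  assumes "radon_measure M"
  shows "sets M = sets borel" "space M = UNIV"
    and "\<And>f. f \<in> borel_measurable M \<longleftrightarrow> f \<in> borel_measurable borel"
proof -
  show "sets M = sets borel" using assms by (simp add: radon_measure_def)
  then show "space M = UNIV" "\<And>f. f \<in> borel_measurable M \<longleftrightarrow> f \<in> borel_measurable borel"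
    using sets_eq_imp_space_eq[of M borel] measurable_cong_sets[of M borel] by auto
qed

lemma radon_measure_bounded:
  assumes "radon_measure M" "bounded B"
  shows "emeasure M B < \<infinity>"
proof -
  have "compact (closure B)" using assms(2) by simp
  then have "emeasure M (closure B) < \<infinity>" using assms(1) unfolding radon_measure_def by blast
  moreover have "emeasure M B \<le> emeasure M (closure B)"
    using radon_measureD[OF assms(1)] by (intro emeasure_mono closure_subset) auto
  ultimately show ?thesis by (rule order.strict_trans1[rotated])
qed

text \<open>The total mass of a Radon measure may be infinite; bounded support supplies the
  finiteness in all later pairings with test functions.\<close>

lemma integrable_radon:
  fixes f :: "plane \<Rightarrow> real"
  assumes M: "radon_measure M" and f: "f \<in> borel_measurable borel"
    and B: "bounded B" "B \<in> sets borel" and C: "\<And>z. z \<in> B \<Longrightarrow> \<bar>f z\<bar> \<le> C"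
    and z: "\<And>z. z \<notin> B \<Longrightarrow> f z = 0"
  shows "integrable M f"
  using radon_measureD[OF M] f B radon_measure_bounded[OF M] C z
  by (intro integrableI_bounded_set[where A=B and B=C]) auto

lemma radon_lborel: "radon_measure lborel"
  unfolding radon_measure_def using emeasure_bounded_finite[OF compact_imp_bounded] by auto

lemma radon_density:
  assumes M: "radon_measure M" and f: "f \<in> borel_measurable borel" and C: "\<And>z. f z \<le> C"
  shows "radon_measure (density M (\<lambda>z. ennreal (f z)))"
  unfolding radon_measure_def
proof (intro conjI allI impI)
  note MD = radon_measureD[OF M]
  show "sets (density M (\<lambda>z. ennreal (f z))) = sets borel" by (simp add: MD)
  fix K :: "plane set" assume K: "compact K"
  then have Kb: "K \<in> sets M" by (simp add: MD borel_compact)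
  have "emeasure (density M (\<lambda>z. ennreal (f z))) K = (\<integral>\<^sup>+z. ennreal (f z) * indicator K z \<partial>M)"
    using f Kb by (intro emeasure_density) (auto simp: MD)
  also have "\<dots> \<le> (\<integral>\<^sup>+z. ennreal C * indicator K z \<partial>M)"
    using C by (intro nn_integral_mono) (auto simp: indicator_def ennreal_leI)
  also have "\<dots> = ennreal C * emeasure M K"
    using Kb by (simp add: nn_integral_cmult_indicator)
  also have "\<dots> < \<infinity>"
    using M K by (auto simp: radon_measure_def ennreal_mult_less_top)
  finally show "emeasure (density M (\<lambda>z. ennreal (f z))) K < \<infinity>" .
qed

lemma signed_of_simps [simp]: "fst (signed_of M) = M" "snd (signed_of M) = null_measure borel"
  by (simp_all add: signed_of_def)

lemma signed_radon_measure_signed_of: "radon_measure M \<Longrightarrow> signed_radon_measure (signed_of M)"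
  by (auto simp: signed_radon_measure_def radon_measure_def intro!: bexI[of _ UNIV])

lemma pairing_signed_of [simp]: "pairing (signed_of M) \<phi> = (\<integral>z. \<phi> z \<partial>M)"
  by (simp add: pairing_def)

lemma concentrated_on_density:
  assumes "concentrated_on S (signed_of M)" "- S \<in> sets M" "f \<in> borel_measurable M"
  shows "concentrated_on S (signed_of (density M f))"
proof -
  have "AE z in M. z \<in> - S \<longrightarrow> f z = 0"
    using assms(1,2) by (intro AE_I'[of "- S"]) (auto simp: concentrated_on_def null_sets_def)
  then show ?thesis
    using assms(2,3) null_sets_density_iff[of f M "- S"] by (auto simp: concentrated_on_def)
qed

lemma abs_cont_density:
  assumes "sets M = sets borel" "f \<in> borel_measurable M"
  shows "signed_of (density M f) \<lless> signed_of M"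
proof -
  have "N \<in> null_sets (density M f)" if "N \<in> null_sets M" for N
    using AE_not_in[OF that] that assms(2) by (auto simp: null_sets_density_iff elim!: eventually_mono)
  then show ?thesis
    using assms(1) by (auto simp: abs_cont_def null_sets_def)
qed

text \<open>\<open>ennreal\<close> cuts negative values off to 0, so the sign condition is what lets
  the density reproduce \<open>f\<close>. The upper bound gives integrability over bounded
  sets.\<close>

lemma is_RN_deriv_density:
  assumes M: "radon_measure M" and f: "f \<in> borel_measurable borel" "\<And>z. 0 \<le> f z" "\<And>z. f z \<le> C"
  shows "is_RN_deriv f (signed_of (density M (\<lambda>z. ennreal (f z)))) (signed_of M)"
  unfolding is_RN_deriv_on_def
proof (intro ballI impI conjI)
  fix B :: "plane set" assume B: "B \<in> sets borel" "bounded B \<and> B \<subseteq> UNIV"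
  note MD = radon_measureD[OF M]
  have I: "integrable M (\<lambda>z. indicator B z * f z)"
    using B f abs_of_nonneg[OF f(2)] by (intro integrable_radon[OF M, where B=B and C=C]) auto
  then show "set_integrable (fst (signed_of M)) B f" by (simp add: set_integrable_def)
  show "set_integrable (snd (signed_of M)) B f"
    using B f by (simp add: set_integrable_def measurable_cong_sets[OF sets_null_measure refl])
  have "emeasure (density M (\<lambda>z. ennreal (f z))) B = (\<integral>\<^sup>+z. ennreal (indicator B z * f z) \<partial>M)"
    using f B by (subst emeasure_density) (auto simp: MD indicator_def intro!: nn_integral_cong)
  also have "\<dots> = ennreal (\<integral>z. indicator B z * f z \<partial>M)"
    using f by (intro nn_integral_eq_integral I) auto
  finally have "measure (density M (\<lambda>z. ennreal (f z))) B = (\<integral>z. indicator B z * f z \<partial>M)"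
    using f by (simp add: measure_def)
  then show "measure (fst (signed_of (density M (\<lambda>z. ennreal (f z))))) B -
        measure (snd (signed_of (density M (\<lambda>z. ennreal (f z))))) B =
      (LINT z:B|fst (signed_of M). f z) - (LINT z:B|snd (signed_of M). f z)"
    by (simp add: set_lebesgue_integral_def)
qed

text \<open>The defining identity speaks of bounded sets only, and \<open>f\<close>,
  \<open>g\<close> need not be integrable over all of \<open>A\<close>. Uniqueness of densities is
  therefore applied on the intersection of \<open>A\<close> with each ball of integer radius, and
  countably many null sets are discarded.\<close>

lemma is_RN_deriv_on_lborel_unique:
  assumes f: "is_RN_deriv_on A f \<nu> (signed_of lborel)" and g: "is_RN_deriv_on A g \<nu> (signed_of lborel)"
    and A: "A \<in> sets borel"
  shows "AE z in lborel. z \<in> A \<longrightarrow> f z = g z"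
proof -
  have "AE z in lborel. indicator (A \<inter> ball 0 (real n)) z * f z = indicator (A \<inter> ball 0 (real n)) z * g z"
    for n
  proof (rule density_unique_real)
    let ?B = "A \<inter> ball 0 (real n)"
    have B: "?B \<in> sets borel" "bounded ?B" "?B \<subseteq> A"
      using A by (auto intro: bounded_subset[OF bounded_ball])
    show "integrable lborel (\<lambda>z. indicator ?B z * f z)" "integrable lborel (\<lambda>z. indicator ?B z * g z)"
      using f g B unfolding is_RN_deriv_on_def set_integrable_def by auto
    fix D :: "plane set" assume D: "D \<in> sets lborel"
    then have BD: "?B \<inter> D \<in> sets borel" "bounded (?B \<inter> D)" "?B \<inter> D \<subseteq> A"
      using B by (auto intro: bounded_subset)
    have eq: "(LINT z:D|lborel. indicator ?B z * h z) = (LINT z:?B \<inter> D|lborel. h z)" for h :: "plane \<Rightarrow> real"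
      unfolding set_lebesgue_integral_def by (rule Bochner_Integration.integral_cong) (auto simp: indicator_def)
    have fg: "measure (fst \<nu>) (?B \<inter> D) - measure (snd \<nu>) (?B \<inter> D) = (LINT z:?B \<inter> D|lborel. h z)"
      if "is_RN_deriv_on A h \<nu> (signed_of lborel)" for h
      using that BD unfolding is_RN_deriv_on_def by (simp add: set_lebesgue_integral_def[of "null_measure borel"])
    show "(LINT z:D|lborel. indicator ?B z * f z) = (LINT z:D|lborel. indicator ?B z * g z)"
      using fg[OF f] fg[OF g] by (simp add: eq)
  qed
  then have "AE z in lborel. \<forall>n. indicator (A \<inter> ball 0 (real n)) z * f z = indicator (A \<inter> ball 0 (real n)) z * g z"
    unfolding AE_all_countable by blast
  then show ?thesis
  proof (rule AE_mp, intro AE_I2 impI)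
    fix z assume *: "\<forall>n. indicator (A \<inter> ball 0 (real n)) z * f z = indicator (A \<inter> ball 0 (real n)) z * g z"
      and "z \<in> A"
    obtain n where "norm z < real n" using reals_Archimedean2 by blast
    with *[rule_format, of n] \<open>z \<in> A\<close> show "f z = g z" by (simp add: indicator_def)
  qed
qed

lemma is_RN_deriv_on_subset: "is_RN_deriv_on A f \<nu> \<mu> \<Longrightarrow> B \<subseteq> A \<Longrightarrow> is_RN_deriv_on B f \<nu> \<mu>"
  unfolding is_RN_deriv_on_def by blast

section \<open>Approximate one-sided limits of functions that are locally constant almost
  everywhere\<close>

lemma open_half_ball: "open (half_ball z \<nu> r)"
proof -
  have "half_ball z \<nu> r = ball z r \<inter> {w. 0 < (w - z) \<bullet> \<nu>}" by (auto simp: half_ball_def)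
  then show ?thesis by (auto intro!: open_Int open_Collect_less continuous_intros)
qed

text \<open>The ball whose diameter runs from \<open>z\<close> to
  \<open>z + r *\<^sub>R \<nu>\<close> fits into the half ball and has area
  \<open>pi * r\<^sup>2 / 4\<close>. A fixed proportion of \<open>r\<^sup>2\<close> is enough for
  the scaled integrals in \<open>one_sided_limit\<close> to detect constants.\<close>

lemma emeasure_half_ball_ge:
  assumes "norm \<nu> = 1" "0 < r"
  shows "ennreal (pi / 4) \<le> emeasure lborel (half_ball z \<nu> r) / ennreal (r\<^sup>2)"
proof -
  let ?c = "z + (r / 2) *\<^sub>R \<nu>"
  have sub: "ball ?c (r / 2) \<subseteq> half_ball z \<nu> r"
  proof
    fix w assume "w \<in> ball ?c (r / 2)"
    then have n: "norm (w - ?c) < r / 2" by (simp add: dist_norm norm_minus_commute)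
    have "norm (w - z) \<le> norm (w - ?c) + norm ((r / 2) *\<^sub>R \<nu>)"
      using norm_triangle_ineq[of "w - ?c" "(r / 2) *\<^sub>R \<nu>"] by (simp add: algebra_simps)
    then have "norm (w - z) < r" using n assms by simp
    moreover have "\<bar>(w - ?c) \<bullet> \<nu>\<bar> < r / 2"
      using Cauchy_Schwarz_ineq2[of "w - ?c" \<nu>] n assms by simp
    moreover have "(w - z) \<bullet> \<nu> = (w - ?c) \<bullet> \<nu> + r / 2"
      using assms by (simp add: inner_diff_left inner_add_left dot_square_norm)
    ultimately show "w \<in> half_ball z \<nu> r"
      by (auto simp: half_ball_def dist_norm norm_minus_commute)
  qed
  have H: "half_ball z \<nu> r \<in> sets lborel" by (simp add: open_half_ball)
  have "ennreal (pi * r\<^sup>2 / 4) = emeasure lborel (ball ?c (r / 2))"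
    using assms by (simp add: emeasure_ball unit_ball_vol_2 power_divide power2_eq_square)
  also have "\<dots> \<le> emeasure lborel (half_ball z \<nu> r)"
    by (intro emeasure_mono sub H)
  finally have "ennreal (pi * r\<^sup>2 / 4) / ennreal (r\<^sup>2) \<le> emeasure lborel (half_ball z \<nu> r) / ennreal (r\<^sup>2)"
    by (rule divide_right_mono_ennreal)
  then show ?thesis using assms by (simp add: divide_ennreal)
qed

text \<open>For small \<open>r\<close> the scaled integral is at least
  \<open>\<bar>k - c\<bar> * (pi / 4)\<close>, so it can tend to 0 only if
  \<open>c = k\<close>.\<close>

lemma one_sided_limit_const:
  assumes lim: "one_sided_limit f z \<nu> c" and \<nu>: "norm \<nu> = 1" and e: "0 < e"
    and ae: "AE w in lborel. w \<in> ball z e \<longrightarrow> f w = k"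
  shows "c = k"
proof -
  have pi_quarter_nonneg: "0 \<le> pi / 4" using pi_ge_zero by simp
  have "ennreal (\<bar>k - c\<bar> * (pi / 4)) \<le>
      (\<integral>\<^sup>+w\<in>half_ball z \<nu> r. ennreal \<bar>f w - c\<bar> \<partial>lborel) / ennreal (r\<^sup>2)" if r: "0 < r" "r < e" for r
  proof -
  have H: "half_ball z \<nu> r \<in> sets lborel" by (simp add: open_half_ball)
    have "(\<integral>\<^sup>+w\<in>half_ball z \<nu> r. ennreal \<bar>f w - c\<bar> \<partial>lborel) =
        (\<integral>\<^sup>+w. ennreal \<bar>k - c\<bar> * indicator (half_ball z \<nu> r) w \<partial>lborel)"
      using ae r by (intro nn_integral_cong_AE) (auto elim!: eventually_mono simp: half_ball_def indicator_def)
    also have "\<dots> = ennreal \<bar>k - c\<bar> * emeasure lborel (half_ball z \<nu> r)"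
      using H by (simp add: nn_integral_cmult_indicator)
    finally show ?thesis
      using mult_left_mono[OF emeasure_half_ball_ge[OF \<nu> r(1), of z], of "ennreal \<bar>k - c\<bar>"]
      by (simp add: ennreal_times_divide ennreal_mult[OF abs_ge_zero pi_quarter_nonneg]
          del: times_divide_eq_right)
  qed
  then have "eventually (\<lambda>r. ennreal (\<bar>k - c\<bar> * (pi / 4)) \<le>
      (\<integral>\<^sup>+w\<in>half_ball z \<nu> r. ennreal \<bar>f w - c\<bar> \<partial>lborel) / ennreal (r\<^sup>2)) (at_right 0)"
    using eventually_at_right_real[OF e] by (auto elim!: eventually_mono)
  then have "ennreal (\<bar>k - c\<bar> * (pi / 4)) \<le> 0"
    using lim unfolding one_sided_limit_def by (intro tendsto_lowerbound[where F="at_right (0::real)"]) auto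
  then have "\<bar>k - c\<bar> * (pi / 4) \<le> 0" by (simp add: ennreal_eq_0_iff)
  then show ?thesis using pi_gt_zero by (simp add: mult_le_0_iff)
qed

text \<open>Differentiability is asked for in the open interval only, since \<open>b\<close> may
  have a corner at 0. Integrability is a separate premise because \<open>f\<close> may be unbounded
  near 0; it identifies the gauge integral of the fundamental theorem with the Lebesgue
  integral.\<close>

lemma lborel_integral_FTC:
  fixes F f :: "real \<Rightarrow> real"
  assumes "0 \<le> T" and cont: "continuous_on {0..T} F"
    and der: "\<And>x. 0 < x \<Longrightarrow> x < T \<Longrightarrow> (F has_real_derivative f x) (at x)"
    and int: "set_integrable lborel {0..T} f"
  shows "(LINT x:{0..T}|lborel. f x) = F T - F 0"
proof -
  have "(f has_integral (F T - F 0)) {0..T}"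
    using der by (intro fundamental_theorem_of_calculus_interior \<open>0 \<le> T\<close> cont)
      (auto simp: has_real_derivative_iff_has_vector_derivative)
  then show ?thesis using set_borel_integral_eq_integral(2)[OF int] by (simp add: integral_unique)
qed

section \<open>Test functions and real calculus\<close>

text \<open>\<open>dx\<close> and \<open>dy\<close> are one-dimensional derivatives along coordinate
  lines; the chain rule identifies them with the values of the total derivative on the two unit
  vectors.\<close>

lemma C1_has_derivative:
  assumes "C1_compact_support \<phi>"
  shows "(\<phi> has_derivative (\<lambda>h. dx \<phi> z * fst h + dy \<phi> z * snd h)) (at z)"
proof -
  obtain D where D: "(\<phi> has_derivative D) (at z)"
    using assms unfolding C1_compact_support_def differentiable_def by blast
  interpret D: bounded_linear D using D by (rule has_derivative_bounded_linear)
  have "((\<lambda>s. \<phi> (s, snd z)) has_derivative (\<lambda>h. D (h, 0))) (at (fst z))"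
    by (rule has_derivative_compose[where g=\<phi> and f="\<lambda>s. (s, snd z)" and g'=D, simplified])
      (use D in \<open>auto intro!: derivative_eq_intros\<close>)
  moreover have "(\<lambda>h. D (h, 0)) = (*) (D (1, 0))"
  proof
    fix h show "D (h, 0) = D (1, 0) * h" using D.scaleR[of h "(1, 0)"] by simp
  qed
  ultimately have x: "dx \<phi> z = D (1, 0)"
    unfolding dx_def by (intro DERIV_imp_deriv) (simp add: has_field_derivative_def)
  have "((\<lambda>s. \<phi> (fst z, s)) has_derivative (\<lambda>h. D (0, h))) (at (snd z))"
    by (rule has_derivative_compose[where g=\<phi> and f="\<lambda>s. (fst z, s)" and g'=D, simplified])
      (use D in \<open>auto intro!: derivative_eq_intros\<close>)
  moreover have "(\<lambda>h. D (0, h)) = (*) (D (0, 1))"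
  proof
    fix h show "D (0, h) = D (0, 1) * h" using D.scaleR[of h "(0, 1)"] by simp
  qed
  ultimately have y: "dy \<phi> z = D (0, 1)"
    unfolding dy_def by (intro DERIV_imp_deriv) (simp add: has_field_derivative_def)
  have "D h = D (1, 0) * fst h + D (0, 1) * snd h" for h
    using D.add[of "fst h *\<^sub>R (1, 0)" "snd h *\<^sub>R (0, 1)"]
    by (simp only: D.scaleR) (simp add: mult.commute)
  then have "(\<lambda>h. dx \<phi> z * fst h + dy \<phi> z * snd h) = D" unfolding x y by (intro ext) (rule sym)
  then show ?thesis
    using D by (rule ssubst[where P="\<lambda>f. (\<phi> has_derivative f) (at z)"])
qed

lemma continuous_vanishing_bounded:
  fixes f :: "'a::euclidean_space \<Rightarrow> real"
  assumes "continuous_on UNIV f" "\<And>z. R < norm z \<Longrightarrow> f z = 0"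
  obtains C where "0 \<le> C" "\<And>z. \<bar>f z\<bar> \<le> C"
proof -
  have "bounded (f ` cball 0 R)"
    by (intro compact_imp_bounded compact_continuous_image continuous_on_subset[OF assms(1)]) auto
  then obtain C where "\<forall>r \<in> f ` cball 0 R. norm r \<le> C" unfolding bounded_iff by blast
  then have C: "\<And>z. z \<in> cball 0 R \<Longrightarrow> \<bar>f z\<bar> \<le> C" by auto
  have "\<bar>f z\<bar> \<le> max C 0" for z
    using C[of z] assms(2)[of z] by (cases "norm z \<le> R") auto
  then show ?thesis using that[of "max C 0"] by auto
qed

lemma C1_compact_support_bounds:
  assumes "C1_compact_support \<phi>"
  obtains T C where "0 < T" "0 \<le> C"
    "\<And>z. \<bar>\<phi> z\<bar> \<le> C" "\<And>z. \<bar>dx \<phi> z\<bar> \<le> C" "\<And>z. \<bar>dy \<phi> z\<bar> \<le> C"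
    "\<And>x y. T \<le> \<bar>x\<bar> \<or> T \<le> \<bar>y\<bar> \<Longrightarrow> \<phi> (x, y) = 0 \<and> dx \<phi> (x, y) = 0 \<and> dy \<phi> (x, y) = 0"
proof -
  have "bounded {z. \<phi> z \<noteq> 0}"
    using assms unfolding C1_compact_support_def
    by (metis bounded_subset closure_subset compact_imp_bounded)
  then obtain R where "0 < R" and R: "\<And>z. R < norm z \<Longrightarrow> \<phi> z = 0"
    unfolding bounded_pos by force
  \<comment> \<open>\<open>\<phi>\<close> vanishes on the whole open set
    \<open>{z. R < norm z}\<close>, so its total derivative is 0 there, and with it both partial
    derivatives.\<close>
  have z: "\<phi> z = 0 \<and> dx \<phi> z = 0 \<and> dy \<phi> z = 0" if "R < norm z" for z
  proof -
    have "(\<phi> has_derivative (\<lambda>_. 0)) (at z)"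
      by (rule has_derivative_transform_within_open[where f="\<lambda>_. 0" and s="{z. R < norm z}"])
        (use that R in \<open>auto intro!: open_Collect_less continuous_intros\<close>)
    then have eq: "(\<lambda>_. 0) = (\<lambda>h. dx \<phi> z * fst h + dy \<phi> z * snd h)"
      using C1_has_derivative[OF assms] has_derivative_unique by blast
    show ?thesis using fun_cong[OF eq, of "(1, 0)"] fun_cong[OF eq, of "(0, 1)"] R that by simp
  qed
  have c: "continuous_on UNIV \<phi>" "continuous_on UNIV (dx \<phi>)" "continuous_on UNIV (dy \<phi>)"
    using assms unfolding C1_compact_support_def
    by (blast intro: continuous_at_imp_continuous_on differentiable_imp_continuous_within)+
  obtain C0 where C0: "0 \<le> C0" "\<And>z. \<bar>\<phi> z\<bar> \<le> C0"
    using continuous_vanishing_bounded[OF c(1)] z by metis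
  obtain C1 where C1: "0 \<le> C1" "\<And>z. \<bar>dx \<phi> z\<bar> \<le> C1"
    using continuous_vanishing_bounded[OF c(2)] z by metis
  obtain C2 where C2: "0 \<le> C2" "\<And>z. \<bar>dy \<phi> z\<bar> \<le> C2"
    using continuous_vanishing_bounded[OF c(3)] z by metis
  \<comment> \<open>The added 1 gives the strict inequality that \<open>z\<close> requires.\<close>
  have far: "R < norm (x, y)" if "R + 1 \<le> \<bar>x\<bar> \<or> R + 1 \<le> \<bar>y\<bar>" for x y :: real
    using that norm_fst_le[of x y] norm_snd_le[of y x] by auto
  show ?thesis
  proof (rule that[of "R + 1" "C0 + C1 + C2"])
    show "\<bar>\<phi> z\<bar> \<le> C0 + C1 + C2" "\<bar>dx \<phi> z\<bar> \<le> C0 + C1 + C2" "\<bar>dy \<phi> z\<bar> \<le> C0 + C1 + C2" for z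
      using C0(1) C1(1) C2(1) C0(2)[of z] C1(2)[of z] C2(2)[of z] by linarith+
  qed (use \<open>0 < R\<close> C0(1) C1(1) C2(1) far z in auto)
qed

lemma C1_borel_measurable:
  assumes "C1_compact_support \<phi>"
  shows "\<phi> \<in> borel_measurable borel" "dx \<phi> \<in> borel_measurable borel" "dy \<phi> \<in> borel_measurable borel"
proof -
  show "dx \<phi> \<in> borel_measurable borel" "dy \<phi> \<in> borel_measurable borel"
    using assms unfolding C1_compact_support_def by (auto intro: borel_measurable_continuous_onI)
  have "isCont \<phi> z" for z
    using assms unfolding C1_compact_support_def by (blast intro: differentiable_imp_continuous_within)
  then show "\<phi> \<in> borel_measurable borel"
    by (intro borel_measurable_continuous_onI continuous_at_imp_continuous_on) simp
qed

lemma deriv_zero_on_negative: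
  fixes f :: "real \<Rightarrow> real"
  assumes "\<And>x. x < 0 \<Longrightarrow> f x = 0" "x < 0"
  shows "deriv f x = 0"
proof (rule DERIV_imp_deriv)
  show "(f has_real_derivative 0) (at x)"
    by (rule has_field_derivative_transform_within_open[where f="\<lambda>_. 0" and S="{..<0}"])
      (use assms in auto)
qed

text \<open>The value at 0 is left free: this covers \<open>deriv b\<close>, whose value at a corner
  is unknown. One point does not affect measurability.\<close>

lemma borel_measurable_zero_on_negative:
  fixes f :: "real \<Rightarrow> real"
  assumes "\<And>x. x < 0 \<Longrightarrow> f x = 0" "continuous_on {0<..} f"
  shows "f \<in> borel_measurable borel"
proof -
  have "f = (\<lambda>x. indicator {0<..} x *\<^sub>R f x + indicator {0} x * f 0)"
  proof
    fix x show "f x = indicator {0<..} x *\<^sub>R f x + indicator {0} x * f 0"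
      using assms(1)[of x] by (cases x "0::real" rule: linorder_cases) auto
  qed
  moreover have "(\<lambda>x. indicator {0<..} x *\<^sub>R f x + indicator {0} x * f 0) \<in> borel_measurable borel"
    by (intro borel_measurable_add borel_measurable_continuous_on_indicator assms(2)) auto
  ultimately show ?thesis by simp
qed

lemma lipschitz_on_deriv_le:
  fixes f :: "real \<Rightarrow> real"
  assumes lip: "L-lipschitz_on {a..c} f" and x: "a < x" "x < c" and D: "(f has_real_derivative D) (at x)"
  shows "\<bar>D\<bar> \<le> L"
proof -
  have "((\<lambda>y. \<bar>(f y - f x) / (y - x)\<bar>) \<longlongrightarrow> \<bar>D\<bar>) (at x)"
    using D unfolding has_field_derivative_iff by (intro tendsto_rabs) simp
  moreover have "eventually (\<lambda>y. \<bar>(f y - f x) / (y - x)\<bar> \<le> L) (at x)"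
  proof -
    have "eventually (\<lambda>y. y \<in> {a<..<c}) (at x)"
      using x by (intro eventually_at_in_open') auto
    moreover have "eventually (\<lambda>y. y \<noteq> x) (at x)" by (simp add: eventually_at_filter)
    ultimately show ?thesis
    proof eventually_elim
      case (elim y)
      then have "\<bar>f y - f x\<bar> \<le> L * \<bar>y - x\<bar>"
        using lipschitz_onD[OF lip, of y x] x by (simp add: dist_real_def)
      then show ?case using elim by (simp add: abs_divide divide_le_eq)
    qed
  qed
  ultimately show ?thesis by (intro tendsto_upperbound) auto
qed

lemma DERIV_nonneg_imp_le:
  fixes f :: "real \<Rightarrow> real"
  assumes "a \<le> c" "continuous_on {a..c} f"
    and "\<And>x. a < x \<Longrightarrow> x < c \<Longrightarrow> (f has_real_derivative f' x) (at x)"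
    and "\<And>x. a < x \<Longrightarrow> x < c \<Longrightarrow> 0 \<le> f' x"
  shows "f a \<le> f c"
proof (rule DERIV_nonneg_imp_increasing_open[OF assms(1) _ assms(2)])
  show "\<exists>y. (f has_real_derivative y) (at x) \<and> 0 \<le> y" if "a < x" "x < c" for x
    using assms(3,4) that by blast
qed

lemma DERIV_pos_imp_pos:
  fixes f :: "real \<Rightarrow> real"
  assumes "\<And>x. 0 < x \<Longrightarrow> (f has_real_derivative f' x) (at x)" "\<And>x. 0 < x \<Longrightarrow> 0 < f' x"
    and "continuous_on UNIV f" "f 0 = 0" "0 < x"
  shows "0 < f x"
proof -
  have "f 0 < f x"
  proof (rule DERIV_pos_imp_increasing_open[OF \<open>0 < x\<close>])
    show "\<exists>y. (f has_real_derivative y) (at t) \<and> 0 < y" if "0 < t" for t using assms(1,2) that by blast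
    show "continuous_on {0..x} f" using assms(3) by (rule continuous_on_subset) auto
  qed
  then show ?thesis using assms by simp
qed

section \<open>Geometry of the ramp\<close>

text \<open>\<open>lipschitz_b\<close> expresses that the wall is a Lipschitz curve. It does not
  follow from \<open>C2_b\<close>, which leaves the slope near 0 uncontrolled: the square root is
  twice continuously differentiable for x > 0.\<close>

locale ramp =
  fixes b :: "real \<Rightarrow> real"
  assumes continuous_b: "continuous_on UNIV b"
    and b_nonpos: "\<And>x. x \<le> 0 \<Longrightarrow> b x = 0"
    and C2_b: "C2_on {0<..} b"
    and lipschitz_b: "\<And>T. \<exists>L. L-lipschitz_on {0..T} b"
    and slope_nonneg: "\<And>x. x > 0 \<Longrightarrow> deriv b x \<ge> 0"
    and weight_ineq: "\<And>x. x > 0 \<Longrightarrow>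
      deriv (deriv b) x * ramp_H b x > - ((deriv b x)\<^sup>2 * sqrt (1 + (deriv b x)\<^sup>2))"
begin

abbreviation "H \<equiv> ramp_H b"
abbreviation "speed x \<equiv> sqrt (1 + (deriv b x)\<^sup>2)"

lemma speed_ge_1: "1 \<le> speed x" and speed_pos: "0 < speed x" and speed_sq: "(speed x)\<^sup>2 = 1 + (deriv b x)\<^sup>2"
proof -
  show "1 \<le> speed x" by simp
  then show "0 < speed x" by linarith
  show "(speed x)\<^sup>2 = 1 + (deriv b x)\<^sup>2" by simp
qed

lemma curve_speed_graph [simp]: "curve_speed (\<lambda>t. t) b x = speed x"
  by (simp add: curve_speed_def)

lemma b_deriv: "0 < x \<Longrightarrow> (b has_real_derivative deriv b x) (at x)"
  and slope_deriv: "0 < x \<Longrightarrow> (deriv b has_real_derivative deriv (deriv b) x) (at x)"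
  using C2_b unfolding C2_on_def DERIV_deriv_iff_real_differentiable by blast+

lemma continuous_slope: "continuous_on {0<..} (deriv b)"
  using slope_deriv by (intro continuous_at_imp_continuous_on) (auto intro: DERIV_isCont)

lemma slope_neg: "x < 0 \<Longrightarrow> deriv b x = 0"
  by (rule deriv_zero_on_negative) (auto simp: b_nonpos)

lemma borel_b [measurable]: "b \<in> borel_measurable borel"
  using continuous_b by (rule borel_measurable_continuous_onI)

lemma borel_slope [measurable]: "deriv b \<in> borel_measurable borel"
  by (rule borel_measurable_zero_on_negative[OF slope_neg continuous_slope])

lemma borel_slope2 [measurable]: "deriv (deriv b) \<in> borel_measurable borel"
  using C2_b by (intro borel_measurable_zero_on_negative deriv_zero_on_negative slope_neg)
    (auto simp: C2_on_def)

lemma slope_bounded: obtains L where "0 \<le> L" "\<And>x. 0 < x \<Longrightarrow> x \<le> T \<Longrightarrow> deriv b x \<le> L"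
proof -
  \<comment> \<open>With \<open>T + 1\<close> the point \<open>x = T\<close> is interior to the
    interval, as \<open>lipschitz_on_deriv_le\<close> demands.\<close>
  obtain L where L: "L-lipschitz_on {0..T + 1} b" using lipschitz_b by blast
  show ?thesis
  proof (rule that[of L])
    show "0 \<le> L" using lipschitz_on_nonneg[OF L] .
    show "deriv b x \<le> L" if "0 < x" "x \<le> T" for x
      using lipschitz_on_deriv_le[OF L _ _ b_deriv] that by fastforce
  qed
qed

lemma slope_div_speed: "\<bar>deriv b x / speed x\<bar> \<le> 1"
proof -
  have "\<bar>deriv b x\<bar> \<le> speed x" by (rule real_le_rsqrt) simp
  then show ?thesis using speed_pos[of x] by (simp add: abs_divide)
qed

lemma H_integrable: "(\<lambda>t. deriv b t / speed t) integrable_on {0..T}"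
proof -
  have "set_integrable lborel {0..T} (\<lambda>t. deriv b t / speed t)"
    unfolding set_integrable_def using slope_div_speed
    by (intro integrableI_bounded_set_indicator[where B=1]) (auto simp: emeasure_lborel_Icc_eq)
  then show ?thesis by (rule set_borel_integral_eq_integral)
qed

lemma H_nonpos: "x \<le> 0 \<Longrightarrow> H x = 0"
  by (cases "x = 0") (auto simp: ramp_H_def)

lemma H_deriv: assumes "0 < x" shows "(H has_real_derivative deriv b x / speed x) (at x)"
proof -
  have "isCont (\<lambda>t. deriv b t / speed t) x"
    using DERIV_isCont[OF slope_deriv[OF assms]] speed_pos[of x] by (intro continuous_intros) auto
  then have "continuous (at x within {0..x + 1} - {}) (\<lambda>t. deriv b t / speed t)"
    by (rule continuous_at_imp_continuous_at_within)
  then have "((\<lambda>u. integral {0..u} (\<lambda>t. deriv b t / speed t)) has_vector_derivative deriv b x / speed x)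
      (at x within {0..x + 1} - {})"
    using assms by (intro integral_has_vector_derivative_continuous_at H_integrable) auto
  moreover have "at x within {0..x + 1} - {} = at x"
    using assms by (intro at_within_interior) auto
  ultimately show ?thesis
    unfolding ramp_H_def[abs_def] by (simp add: has_real_derivative_iff_has_vector_derivative)
qed

text \<open>\<open>H_deriv\<close> says nothing at 0. There continuity comes from gluing the
  indefinite integral on \<open>{0..1}\<close> to the zero function on \<open>{..0}\<close>.\<close>

lemma continuous_H: "continuous_on UNIV H"
proof -
  have "continuous_on {0..1} H"
    unfolding ramp_H_def[abs_def] by (rule indefinite_integral_continuous_1[OF H_integrable])
  moreover have "continuous_on {..0} H"
    by (rule continuous_on_eq[where f="\<lambda>_. 0"]) (auto simp: H_nonpos)
  ultimately have "continuous_on ({..0} \<union> {0..1}) H" by (intro continuous_on_closed_Un) auto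
  moreover have "{..0} \<union> {0..1} = {..1::real}" by auto
  ultimately have *: "continuous_on {..1} H" by simp
  have "isCont H x" for x
  proof (cases "x < 1")
    case True
    then show ?thesis by (intro continuous_on_interior[OF *]) auto
  next
    case False
    then show ?thesis by (intro DERIV_isCont[OF H_deriv]) auto
  qed
  then show ?thesis by (simp add: continuous_at_imp_continuous_on)
qed

lemma borel_H [measurable]: "H \<in> borel_measurable borel"
  using continuous_H by (rule borel_measurable_continuous_onI)

lemma H_nonneg: "0 \<le> H x"
proof (cases "0 \<le> x")
  case True
  have "H 0 \<le> H x"
    by (rule DERIV_nonneg_imp_le[OF True continuous_on_subset[OF continuous_H] H_deriv])
      (use slope_nonneg in auto)
  then show ?thesis by (simp add: H_nonpos)
qed (simp add: H_nonpos)

lemma slope_pos: assumes "0 < x" shows "0 < deriv b x"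
proof (rule ccontr)
  assume "\<not> 0 < deriv b x"
  then have 0: "deriv b x = 0" using slope_nonneg[OF assms] by simp
  \<comment> \<open>\<open>x\<close> would be a minimum of \<open>b'\<close>, contradicting \<open>b''(x) H(x) > 0\<close>.\<close>
  have "deriv (deriv b) x = 0"
    by (rule DERIV_local_min[OF slope_deriv[OF assms], of x]) (use assms 0 slope_nonneg in auto)
  then show False using weight_ineq[OF assms] 0 by simp
qed

lemma H_pos: "0 < x \<Longrightarrow> 0 < H x"
  by (rule DERIV_pos_imp_pos[OF H_deriv _ continuous_H]) (simp_all only: slope_pos speed_pos H_nonpos divide_pos_pos order_refl)

lemma b_pos: "0 < x \<Longrightarrow> 0 < b x"
  by (rule DERIV_pos_imp_pos[OF b_deriv _ continuous_b]) (auto simp: slope_pos b_nonpos)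

lemma b_nonneg: "0 \<le> b x"
  using b_pos[of x] b_nonpos[of x] by (cases "0 < x") auto

text \<open>Both functions vanish at 0, and the derivative of \<open>H\<close> is the slope divided
  by a speed of at least 1. This is the source of the upper bound 1 for \<open>U\<close> and
  \<open>V\<close>.\<close>

lemma H_le_b: "H x \<le> b x"
proof (cases "0 \<le> x")
  case True
  have "b 0 - H 0 \<le> b x - H x"
  proof (rule DERIV_nonneg_imp_le[OF True])
    show "continuous_on {0..x} (\<lambda>x. b x - H x)"
      by (intro continuous_intros continuous_on_subset[OF continuous_b] continuous_on_subset[OF continuous_H]) auto
    show "((\<lambda>x. b x - H x) has_real_derivative deriv b t - deriv b t / speed t) (at t)" if "0 < t" for t
      using that by (intro DERIV_diff b_deriv H_deriv)
    show "0 \<le> deriv b t - deriv b t / speed t" if "0 < t" for t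
      using mult_left_mono[OF speed_ge_1[of t] slope_nonneg[OF that]] speed_pos[of t] by (simp add: field_simps)
  qed
  then show ?thesis by (simp add: H_nonpos b_nonpos)
qed (simp add: H_nonpos b_nonpos)

text \<open>A converse to \<open>H_le_b\<close>: where the slope is at most \<open>L\<close>, the
  speed is at most \<open>sqrt (1 + L\<^sup>2)\<close>. It keeps \<open>b x / H x\<close> bounded as
  \<open>x\<close> tends to 0, although numerator and denominator both vanish there.\<close>

lemma b_le_H:
  assumes L: "\<And>x. 0 < x \<Longrightarrow> x \<le> T \<Longrightarrow> deriv b x \<le> L" and x: "x \<le> T"
  shows "b x \<le> sqrt (1 + L\<^sup>2) * H x"
proof (cases "0 \<le> x")
  case True
  let ?M = "sqrt (1 + L\<^sup>2)"
  have "?M * H 0 - b 0 \<le> ?M * H x - b x"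
  proof (rule DERIV_nonneg_imp_le[OF True])
    show "continuous_on {0..x} (\<lambda>x. ?M * H x - b x)"
      by (intro continuous_intros continuous_on_subset[OF continuous_b] continuous_on_subset[OF continuous_H]) auto
    show "((\<lambda>x. ?M * H x - b x) has_real_derivative ?M * (deriv b t / speed t) - deriv b t) (at t)" if "0 < t" for t
      using that by (intro DERIV_diff b_deriv H_deriv DERIV_cmult)
    show "0 \<le> ?M * (deriv b t / speed t) - deriv b t" if "0 < t" "t < x" for t
    proof -
      have "speed t \<le> ?M"
        using L[of t] slope_nonneg[of t] that x by (auto intro!: power_mono)
      then show ?thesis
        using mult_right_mono[OF _ slope_nonneg[OF that(1)], of "speed t" ?M] speed_pos[of t]
        by (simp add: field_simps)
    qed
  qed
  then show ?thesis by (simp add: H_nonpos b_nonpos)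
qed (simp add: H_nonpos b_nonpos)

end

section \<open>Functions of one coordinate, and local boundedness on the half line\<close>

lemma
  fixes f :: "real \<Rightarrow> real"
  assumes "f \<in> borel_measurable borel"
  shows borel_measurable_fst_comp: "(\<lambda>z :: plane. f (fst z)) \<in> borel_measurable borel"
    and borel_measurable_snd_comp: "(\<lambda>z :: plane. f (snd z)) \<in> borel_measurable borel"
  using assms
  by (rule measurable_compose[rotated], intro borel_measurable_continuous_onI continuous_intros)+

text \<open>The bound is uniform down to 0 but leaves out 0 itself, where \<open>deriv b\<close> has
  an uncontrolled value that no integral sees.\<close>

definition loc_bounded :: "(real \<Rightarrow> real) \<Rightarrow> bool" where
  "loc_bounded f \<longleftrightarrow> f \<in> borel_measurable borel \<and> (\<forall>T. \<exists>C. \<forall>x. 0 < x \<and> x \<le> T \<longrightarrow> \<bar>f x\<bar> \<le> C)"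

lemma loc_boundedI:
  assumes "f \<in> borel_measurable borel" "\<And>x. \<bar>f x\<bar> \<le> C"
  shows "loc_bounded f"
  using assms unfolding loc_bounded_def by blast

lemma loc_bounded_continuous:
  assumes "continuous_on UNIV f"
  shows "loc_bounded f"
proof -
  have "\<exists>C. \<forall>x. 0 < x \<and> x \<le> T \<longrightarrow> \<bar>f x\<bar> \<le> C" for T
  proof -
    have "bounded (f ` {0..T})"
      by (intro compact_imp_bounded compact_continuous_image continuous_on_subset[OF assms]) auto
    then obtain C where "\<forall>r \<in> f ` {0..T}. norm r \<le> C" unfolding bounded_iff by blast
    then show ?thesis by (intro exI[of _ C]) auto
  qed
  then show ?thesis using assms by (auto simp: loc_bounded_def intro: borel_measurable_continuous_onI)
qed

lemma loc_bounded_mult: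
  assumes f: "loc_bounded f" and g: "loc_bounded g"
  shows "loc_bounded (\<lambda>x. f x * g x)"
  unfolding loc_bounded_def
proof (intro conjI allI)
  show "(\<lambda>x. f x * g x) \<in> borel_measurable borel"
    using assms by (auto simp: loc_bounded_def)
  fix T
  obtain C D where C: "\<And>x. 0 < x \<Longrightarrow> x \<le> T \<Longrightarrow> \<bar>f x\<bar> \<le> C" and D: "\<And>x. 0 < x \<Longrightarrow> x \<le> T \<Longrightarrow> \<bar>g x\<bar> \<le> D"
    using f g unfolding loc_bounded_def by meson
  have "\<bar>f x * g x\<bar> \<le> \<bar>C\<bar> * \<bar>D\<bar>" if "0 < x" "x \<le> T" for x
    using mult_mono[of "\<bar>f x\<bar>" "\<bar>C\<bar>" "\<bar>g x\<bar>" "\<bar>D\<bar>"] C[OF that] D[OF that] by (simp add: abs_mult)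
  then show "\<exists>C. \<forall>x. 0 < x \<and> x \<le> T \<longrightarrow> \<bar>f x * g x\<bar> \<le> C" by blast
qed

text \<open>Meant for \<open>f = weight\<close>, which may be unbounded near 0, so that
  \<open>loc_bounded_mult\<close> does not apply.\<close>

lemma set_integrable_mult_loc_bounded:
  assumes f: "set_integrable lborel {0..T} f" and g: "loc_bounded g"
  shows "set_integrable lborel {0..T} (\<lambda>x. f x * g x)"
proof -
  obtain C where C: "\<And>x. 0 < x \<Longrightarrow> x \<le> T \<Longrightarrow> \<bar>g x\<bar> \<le> C"
    using g unfolding loc_bounded_def by meson
  have I: "integrable lborel (\<lambda>x. C * (indicator {0..T} x * f x))"
    using f unfolding set_integrable_def by simp
  have "(\<lambda>x. indicator {0..T} x * f x) \<in> borel_measurable lborel"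
    using f unfolding set_integrable_def by (auto dest: borel_measurable_integrable)
  moreover have "g \<in> borel_measurable lborel" using g by (simp add: loc_bounded_def)
  ultimately have "(\<lambda>x. indicator {0..T} x * f x * g x) \<in> borel_measurable lborel"
    by (rule borel_measurable_times)
  \<comment> \<open>The point 0 is discarded because the bound \<open>C\<close> holds for
    \<open>0 < x\<close> only.\<close>
  moreover have "AE x in lborel. norm (indicator {0..T} x * f x * g x) \<le> norm (C * (indicator {0..T} x * f x))"
    using AE_lborel_singleton[of 0]
  proof eventually_elim
    case (elim x)
    show ?case
    proof (cases "x \<in> {0..T}")
      case True
      then have "\<bar>f x\<bar> * \<bar>g x\<bar> \<le> \<bar>f x\<bar> * \<bar>C\<bar>"
        using C[of x] elim by (intro mult_left_mono) auto
      then show ?thesis using True by (simp add: abs_mult mult.commute)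
    qed simp
  qed
  ultimately have "integrable lborel (\<lambda>x. indicator {0..T} x * f x * g x)"
    by (rule Bochner_Integration.integrable_bound[OF I])
  then show ?thesis unfolding set_integrable_def by (simp add: mult.assoc)
qed

lemma set_integrable_loc_bounded: "loc_bounded f \<Longrightarrow> set_integrable lborel {0..T} f"
  using set_integrable_mult_loc_bounded[of T "\<lambda>_. 1" f]
  by (simp add: set_integrable_def emeasure_lborel_Icc_eq)

section \<open>The measure \<open>R\<close> on the domain and the wall, and the velocity fields
  \<open>U\<close> and \<open>V\<close>\<close>

context ramp
begin

abbreviation "\<Omega> \<equiv> ramp_domain b"
abbreviation "W \<equiv> ramp_wall b"
abbreviation "wall_density x \<equiv> (b x)\<^sup>2 / H x"
abbreviation "\<beta> \<equiv> wall_dirac b (\<lambda>x. (b x)\<^sup>2 / H x)"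
abbreviation "R \<equiv> add_measure (density lborel (indicator \<Omega>)) \<beta>"
abbreviation "U \<equiv> \<lambda>(x, y). indicator \<Omega> (x, y) + H x / (b x * speed x) * indicator W (x, y)"
abbreviation "V \<equiv> \<lambda>(x, y). deriv b x * H x / (b x * speed x) * indicator W (x, y)"
abbreviation "weight x \<equiv> (deriv (deriv b) x * H x + (deriv b x)\<^sup>2 * speed x) / (1 + (deriv b x)\<^sup>2) powr (3 / 2)"

lemma isCont_b: "isCont b x"
  using continuous_b by (simp add: continuous_on_eq_continuous_at)

lemma continuous_b_fst: "continuous_on S (\<lambda>z :: plane. b (fst z))"
  by (rule continuous_on_compose2[OF continuous_b continuous_on_fst[OF continuous_on_id]]) auto

lemma open_domain: "open \<Omega>"
proof -
  have "\<Omega> = {z. 0 < fst z} \<inter> {z. b (fst z) < snd z}" by (auto simp: ramp_domain_def)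
  then show ?thesis
    by (auto intro!: open_Int open_Collect_less continuous_b_fst continuous_intros)
qed

lemma closed_wall: "closed W"
proof -
  have "W = {z. 0 \<le> fst z} \<inter> {z. snd z = b (fst z)}" by (auto simp: ramp_wall_def)
  then show ?thesis
    by (auto intro!: closed_Int closed_Collect_le closed_Collect_eq continuous_b_fst continuous_intros)
qed

lemma borel_domain [measurable]: "\<Omega> \<in> sets borel" using open_domain by simp
lemma borel_wall [measurable]: "W \<in> sets borel" using closed_wall by (rule borel_closed)

lemma closure_domain: "closure \<Omega> \<subseteq> {z. 0 \<le> fst z \<and> b (fst z) \<le> snd z}"
proof (rule closure_minimal)
  show "closed {z :: plane. 0 \<le> fst z \<and> b (fst z) \<le> snd z}"
    by (intro closed_Collect_conj closed_Collect_le continuous_b_fst continuous_intros)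
qed (auto simp: ramp_domain_def)

lemma wall_subset_closure: "W \<subseteq> closure \<Omega>"
proof
  fix z assume "z \<in> W"
  then obtain x where x: "0 \<le> x" and z: "z = (x, b x)" by (auto simp: ramp_wall_def)
  \<comment> \<open>The shift of the first coordinate makes it positive even at the corner
    \<open>x = 0\<close>; the shift of the second lifts the point strictly above the wall.\<close>
  let ?f = "\<lambda>n. (x + inverse (real (Suc n)), b (x + inverse (real (Suc n))) + inverse (real (Suc n)))"
  have "(\<lambda>n. x + inverse (real (Suc n))) \<longlonglongrightarrow> x + 0"
    by (intro tendsto_intros LIMSEQ_inverse_real_of_nat)
  then have 1: "(\<lambda>n. x + inverse (real (Suc n))) \<longlonglongrightarrow> x" by simp
  have "(\<lambda>n. b (x + inverse (real (Suc n))) + inverse (real (Suc n))) \<longlonglongrightarrow> b x + 0"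
    by (intro tendsto_add isCont_tendsto_compose[OF isCont_b 1] LIMSEQ_inverse_real_of_nat)
  then have "?f \<longlonglongrightarrow> z" unfolding z using 1 by (intro tendsto_Pair) simp_all
  moreover have "?f n \<in> \<Omega>" for n
    using x by (auto simp: ramp_domain_def intro!: add_nonneg_pos)
  ultimately show "z \<in> closure \<Omega>" unfolding closure_sequential by (intro exI[of _ ?f]) auto
qed

text \<open>Small steps to the left and downwards stay in the closure, which turns its weak
  inequalities into strict ones. For the entropy condition this places every admissible point in the
  open set where the state is constant.\<close>

lemma interior_closure_domain: "interior (closure \<Omega>) \<subseteq> \<Omega>"
proof
  fix z assume "z \<in> interior (closure \<Omega>)"
  then obtain e where e: "0 < e" "ball z e \<subseteq> closure \<Omega>" by (auto simp: mem_interior)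
  obtain x y where z: "z = (x, y)" by (cases z)
  have "(x - e / 2, y) \<in> ball z e" "(x, y - e / 2) \<in> ball z e"
    using e(1) by (auto simp: z dist_Pair_Pair dist_real_def)
  then have "0 \<le> x - e / 2" "b x \<le> y - e / 2"
    using e(2) closure_domain by fastforce+
  then show "z \<in> \<Omega>" using e(1) by (simp add: z ramp_domain_def)
qed

lemma U_domain: "z \<in> \<Omega> \<Longrightarrow> U z = 1" and V_domain: "z \<in> \<Omega> \<Longrightarrow> V z = 0"
  by (auto simp: ramp_domain_def ramp_wall_def split: prod.split)

lemma U_wall: "0 \<le> x \<Longrightarrow> U (x, b x) = H x / (b x * speed x)"
  and V_wall: "0 \<le> x \<Longrightarrow> V (x, b x) = deriv b x * H x / (b x * speed x)"
  by (auto simp: ramp_domain_def ramp_wall_def)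

lemma U_outside: "z \<notin> \<Omega> \<Longrightarrow> z \<notin> W \<Longrightarrow> U z = 0" and V_outside: "z \<notin> W \<Longrightarrow> V z = 0"
  by (auto split: prod.split)

lemma U_V_wall_bounds:
  assumes "0 \<le> x"
  shows "0 \<le> H x / (b x * speed x)" "H x / (b x * speed x) \<le> 1"
    "0 \<le> deriv b x * H x / (b x * speed x)" "deriv b x * H x / (b x * speed x) \<le> 1"
proof -
  \<comment> \<open>Where \<open>b x = 0\<close> the quotient is 0 by convention, so both bounds
    survive at the corner.\<close>
  have q: "0 \<le> H x / b x" "H x / b x \<le> 1"
    using H_nonneg[of x] H_le_b[of x] b_nonneg[of x] by (auto simp: divide_le_eq_1)
  have U: "H x / (b x * speed x) = (H x / b x) * (1 / speed x)" by simp
  have V: "deriv b x * H x / (b x * speed x) = (H x / b x) * (deriv b x / speed x)" by simp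
  have s: "0 \<le> 1 / speed x" "1 / speed x \<le> 1"
    using speed_ge_1[of x] speed_pos[of x] by (auto simp: divide_le_eq_1 simp del: real_sqrt_ge_1_iff)
  show "0 \<le> H x / (b x * speed x)" unfolding U by (intro mult_nonneg_nonneg q s)
  show "H x / (b x * speed x) \<le> 1" unfolding U by (rule mult_le_one[OF q(2) s])
  have d: "deriv b x / speed x \<le> 1" using slope_div_speed[of x] by linarith
  have "0 \<le> deriv b x * H x / (b x * speed x) \<and> deriv b x * H x / (b x * speed x) \<le> 1"
  \<comment> \<open>The sign of \<open>deriv b 0\<close> is unknown, but \<open>b 0 = 0\<close>
    makes the quotient 0 there.\<close>
  proof (cases "x = 0")
    case False
    then have "0 \<le> deriv b x / speed x" using assms slope_nonneg[of x] speed_pos[of x] by simp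
    then show ?thesis unfolding V using q d by (intro conjI mult_nonneg_nonneg mult_le_one)
  qed (simp add: b_nonpos)
  then show "0 \<le> deriv b x * H x / (b x * speed x)" "deriv b x * H x / (b x * speed x) \<le> 1" by auto
qed

lemma U_bounds: "0 \<le> U z" "U z \<le> 1" and V_bounds: "0 \<le> V z" "V z \<le> 1"
proof -
  have "0 \<le> U z \<and> U z \<le> 1 \<and> 0 \<le> V z \<and> V z \<le> 1"
  proof -
    consider "z \<in> \<Omega>" | "z \<notin> \<Omega>" "z \<notin> W" | x where "0 \<le> x" "z = (x, b x)"
      by (auto simp: ramp_wall_def)
    then show ?thesis
    proof cases
      case 1
      then show ?thesis by (simp only: U_domain V_domain) simp
    next
      case 2
      then show ?thesis by (simp only: U_outside[OF 2] V_outside[OF 2(2)]) simp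
    next
      case 3
      then show ?thesis using U_V_wall_bounds[of x] by (simp only: U_wall V_wall)
    qed
  qed
  then show "0 \<le> U z" "U z \<le> 1" "0 \<le> V z" "V z \<le> 1" by blast+
qed

lemma borel_U: "U \<in> borel_measurable borel" and borel_V: "V \<in> borel_measurable borel"
proof -
  note [measurable] = borel_measurable_fst_comp
  show "U \<in> borel_measurable borel" "V \<in> borel_measurable borel"
    unfolding case_prod_unfold by (simp_all, measurable)
qed

lemma speed_loc_bounded: "loc_bounded speed" and slope_loc_bounded: "loc_bounded (deriv b)"
proof -
  have s: "\<bar>deriv b x\<bar> \<le> L" if "0 < x" "deriv b x \<le> L" for x L
    using slope_nonneg[of x] that by simp
  show "loc_bounded (deriv b)"
    unfolding loc_bounded_def using slope_bounded s by (metis borel_slope)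
  show "loc_bounded speed"
    unfolding loc_bounded_def
  proof (intro conjI allI)
    fix T
    obtain L where L: "0 \<le> L" "\<And>x. 0 < x \<Longrightarrow> x \<le> T \<Longrightarrow> deriv b x \<le> L" using slope_bounded by blast
    have "\<bar>speed x\<bar> \<le> sqrt (1 + L\<^sup>2)" if "0 < x" "x \<le> T" for x
      using L(2)[OF that] slope_nonneg[of x] that by (auto intro!: power_mono)
    then show "\<exists>C. \<forall>x. 0 < x \<and> x \<le> T \<longrightarrow> \<bar>speed x\<bar> \<le> C" by blast
  qed measurable
qed

lemma wall_density_loc_bounded: "loc_bounded (\<lambda>x. wall_density x)"
  unfolding loc_bounded_def
proof (intro conjI allI)
  fix T
  obtain L where L: "0 \<le> L" "\<And>x. 0 < x \<Longrightarrow> x \<le> T \<Longrightarrow> deriv b x \<le> L" using slope_bounded by blast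
  obtain C where C: "\<And>x. 0 < x \<Longrightarrow> x \<le> T \<Longrightarrow> \<bar>b x\<bar> \<le> C"
    using loc_bounded_continuous[OF continuous_b] unfolding loc_bounded_def by meson
  have "\<bar>wall_density x\<bar> \<le> C * sqrt (1 + L\<^sup>2)" if x: "0 < x" "x \<le> T" for x
  proof -
    \<comment> \<open>The first factor is bounded by continuity of \<open>b\<close>, the second by
      \<open>b_le_H\<close>.\<close>
    have "\<bar>wall_density x\<bar> = b x * (b x / H x)"
      using b_pos[of x] H_pos[of x] x by (simp add: power2_eq_square)
    also have "\<dots> \<le> C * sqrt (1 + L\<^sup>2)"
    proof (rule mult_mono)
      show "b x \<le> C" using C[OF x] by simp
      then show "0 \<le> C" using b_nonneg[of x] by simp
      show "b x / H x \<le> sqrt (1 + L\<^sup>2)"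
        using b_le_H[of T L x] L x H_pos[of x] by (simp add: divide_le_eq)
    qed (use b_nonneg H_nonneg in simp)
    finally show ?thesis .
  qed
  then show "\<exists>C. \<forall>x. 0 < x \<and> x \<le> T \<longrightarrow> \<bar>wall_density x\<bar> \<le> C" by blast
qed measurable

lemma wall_density_nonneg: "0 \<le> wall_density x" using H_nonneg by simp

lemma param_domain_infinity [simp]: "param_domain \<infinity> = {0..}" by (auto simp: param_domain_def)

lemma graph_measurable: "(\<lambda>t. (t, b t)) \<in> borel \<rightarrow>\<^sub>M (borel :: plane measure)" by measurable

lemma sets_wall: "sets \<beta> = sets borel" by (simp add: curve_dirac_def)

lemma wall_measure_eq: "A \<in> sets borel \<Longrightarrow> emeasure \<beta> A =
    (\<integral>\<^sup>+t. ennreal (indicator {0..} t * (wall_density t * speed t)) * indicator A (t, b t) \<partial>lborel)"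
  unfolding curve_dirac_def param_domain_infinity curve_speed_graph
  using measurable_sets[OF graph_measurable, of A]
  by (subst emeasure_distr) (auto simp: emeasure_density indicator_def intro!: nn_integral_cong)

lemma radon_wall: "radon_measure \<beta>"
  unfolding radon_measure_def
proof (intro conjI allI impI)
  show "sets \<beta> = sets borel" by (rule sets_wall)
  fix K :: "plane set" assume K: "compact K"
  obtain T where T: "\<And>z. z \<in> K \<Longrightarrow> norm z \<le> T"
    using compact_imp_bounded[OF K] unfolding bounded_iff by blast
  have I: "set_integrable lborel {0..T} (\<lambda>t. wall_density t * speed t)"
    by (intro set_integrable_loc_bounded loc_bounded_mult wall_density_loc_bounded speed_loc_bounded)
  \<comment> \<open>Since \<open>\<bar>t\<bar> \<le> norm (t, b t)\<close>, a point of the wall lies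
    in \<open>K\<close> only if its parameter is in \<open>{0..T}\<close>.\<close>
  have "emeasure \<beta> K \<le> (\<integral>\<^sup>+t. ennreal (norm (indicator {0..T} t *\<^sub>R (wall_density t * speed t))) \<partial>lborel)"
    unfolding wall_measure_eq[OF borel_compact[OF K]]
  proof (rule nn_integral_mono)
    fix t show "ennreal (indicator {0..} t * (wall_density t * speed t)) * indicator K (t, b t) \<le>
        ennreal (norm (indicator {0..T} t *\<^sub>R (wall_density t * speed t)))"
      using T[of "(t, b t)"] norm_fst_le[of t "b t"] H_nonneg[of t]
      by (auto simp: indicator_def)
  qed
  also have "\<dots> < \<infinity>" using I unfolding set_integrable_def integrable_iff_bounded by blast
  finally show "emeasure \<beta> K < \<infinity>" .
qed

lemma density_domain: "density lborel (indicator \<Omega>) = density lborel (\<lambda>z. ennreal (indicator \<Omega> z))"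
  by (simp add: ennreal_indicator)

lemma radon_domain: "radon_measure (density lborel (indicator \<Omega>))"
  unfolding density_domain by (rule radon_density[OF radon_lborel, where C=1]) (auto simp: indicator_def)

lemma emeasure_R: "A \<in> sets borel \<Longrightarrow> emeasure R A = emeasure lborel (\<Omega> \<inter> A) + emeasure \<beta> A"
  by (subst emeasure_add_measure)
    (auto simp: sets_wall emeasure_density indicator_inter_arith[symmetric] ennreal_indicator)

lemma radon_R: "radon_measure R"
  unfolding radon_measure_def
proof (intro conjI allI impI)
  fix K :: "plane set" assume K: "compact K"
  then show "emeasure R K < \<infinity>"
    using radon_wall radon_domain
    by (subst emeasure_add_measure) (auto simp: radon_measure_def borel_compact sets_wall)
qed simp

lemma wall_null:
  assumes "A \<in> sets borel" "A \<inter> W = {}"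
  shows "emeasure \<beta> A = 0"
proof -
  have "ennreal (indicator {0..} t * (wall_density t * speed t)) * indicator A (t, b t) = 0" for t
    using assms(2) by (auto simp: ramp_wall_def indicator_def)
  then show ?thesis unfolding wall_measure_eq[OF assms(1)] by (simp only: nn_integral_const mult_zero_left)
qed

lemma concentrated_R: "concentrated_on (closure \<Omega>) (signed_of R)"
proof -
  have "emeasure \<beta> (- closure \<Omega>) = 0"
    using wall_subset_closure by (intro wall_null borel_open open_Compl closed_closure) auto
  moreover have "\<Omega> \<inter> - closure \<Omega> = {}" using closure_subset by auto
  ultimately show ?thesis by (simp add: concentrated_on_def emeasure_R)
qed

text \<open>The bounded support of \<open>f\<close> truncates the wall integral at \<open>T\<close>,
  where local integrability and integration by parts on a compact interval are available.\<close>

lemma integral_R: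
  fixes f :: "plane \<Rightarrow> real"
  assumes f: "f \<in> borel_measurable borel" "\<And>z. \<bar>f z\<bar> \<le> C" "\<And>x y. T \<le> \<bar>x\<bar> \<or> T \<le> \<bar>y\<bar> \<Longrightarrow> f (x, y) = 0"
  shows "(\<integral>z. f z \<partial>R) = (LINT z:\<Omega>|lborel. f z) + (LINT x:{0..T}|lborel. f (x, b x) * (wall_density x * speed x))"
proof -
  let ?B = "{-\<bar>T\<bar>..\<bar>T\<bar>} \<times> {-\<bar>T\<bar>..\<bar>T\<bar>}"
  have I: "integrable M f" if "radon_measure M" for M
  proof (rule integrable_radon[OF that f(1), of ?B C])
    show "bounded ?B" by (intro bounded_Times) auto
    show "?B \<in> sets borel" by (intro borel_closed closed_Times) auto
    show "f z = 0" if "z \<notin> ?B" for z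
    proof -
      have "T \<le> \<bar>fst z\<bar> \<or> T \<le> \<bar>snd z\<bar>" using that by (cases z) (auto simp: abs_if split: if_splits)
      from f(3)[OF this] show ?thesis by simp
    qed
  qed (use f in auto)
  have "(\<integral>z. f z \<partial>R) = (\<integral>z. f z \<partial>density lborel (indicator \<Omega>)) + (\<integral>z. f z \<partial>\<beta>)"
    using radon_wall radon_domain by (intro integral_add_measure I) (auto simp: sets_wall)
  also have "(\<integral>z. f z \<partial>density lborel (indicator \<Omega>)) = (LINT z:\<Omega>|lborel. f z)"
    unfolding density_domain set_lebesgue_integral_def using f(1) by (subst integral_density) auto
  also have "(\<integral>z. f z \<partial>\<beta>) = (LINT x:{0..}|lborel. wall_density x * f (x, b x) * speed x)"
    using f(1) wall_density_nonneg
    by (subst integral_curve_dirac) (auto simp: curve_pairing_def set_borel_measurable_def)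
  also have "\<dots> = (LINT x:{0..T}|lborel. f (x, b x) * (wall_density x * speed x))"
    unfolding set_lebesgue_integral_def using f(3)
    by (intro Bochner_Integration.integral_cong) (auto simp: indicator_def)
  finally show ?thesis .
qed


section \<open>Integration of \<open>dx \<phi>\<close> over the domain\<close>

lemma C1_graph_deriv:
  assumes \<phi>: "C1_compact_support \<phi>" and x: "0 < x"
  shows "((\<lambda>x. \<phi> (x, b x + s)) has_real_derivative
    dx \<phi> (x, b x + s) + deriv b x * dy \<phi> (x, b x + s)) (at x)"
proof -
  have "((\<lambda>x. (x, b x + s)) has_derivative (\<lambda>h. (h, deriv b x * h))) (at x)"
    using b_deriv[OF x] by (auto intro!: derivative_eq_intros simp: has_field_derivative_def)
  from has_derivative_compose[OF this C1_has_derivative[OF \<phi>]]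
  show ?thesis
    unfolding has_field_derivative_def
    by (rule has_derivative_eq_rhs) (simp add: fun_eq_iff algebra_simps)
qed

lemma continuous_C1:
  assumes "C1_compact_support \<phi>"
  shows "continuous_on UNIV \<phi>"
  using C1_has_derivative[OF assms] by (intro continuous_at_imp_continuous_on ballI has_derivative_continuous)

lemma continuous_C1_graph:
  assumes "C1_compact_support \<phi>"
  shows "continuous_on UNIV (\<lambda>x. \<phi> (x, b x + s))"
  by (rule continuous_on_compose2[OF continuous_C1[OF assms]])
    (auto intro!: continuous_intros continuous_b)

text \<open>The divergence theorem for the field \<open>(\<phi>, 0)\<close>, with boundary terms on
  the wall and on the inflow line. In sheared coordinates the domain is a quadrant, so both families
  of slices are half lines and Fubini reduces everything to the fundamental theorem in one variable.
  Only \<open>dx\<close> has to be integrated over \<open>\<Omega>\<close>, because the fluxes in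
  \<open>y\<close> vanish there with \<open>v\<close>.\<close>

lemma integral_x_derivative_domain:
  assumes \<phi>: "C1_compact_support \<phi>"
  shows "(LINT z:\<Omega>|lborel. dx \<phi> z) =
    (LINT x:{0..}|lborel. deriv b x * \<phi> (x, b x)) - (LINT y:{0..}|lborel. \<phi> (0, y))"
proof -
  obtain T C where T: "0 < T" "0 \<le> C"
    and C: "\<And>z. \<bar>\<phi> z\<bar> \<le> C" "\<And>z. \<bar>dx \<phi> z\<bar> \<le> C" "\<And>z. \<bar>dy \<phi> z\<bar> \<le> C"
    and far: "\<And>x y. T \<le> \<bar>x\<bar> \<or> T \<le> \<bar>y\<bar> \<Longrightarrow> \<phi> (x, y) = 0 \<and> dx \<phi> (x, y) = 0 \<and> dy \<phi> (x, y) = 0"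
    using C1_compact_support_bounds[OF \<phi>] by metis
  obtain L where L: "0 \<le> L" "\<And>x. 0 < x \<Longrightarrow> x \<le> T \<Longrightarrow> deriv b x \<le> L" using slope_bounded by blast
  have [measurable]: "\<phi> \<in> borel_measurable borel" "dx \<phi> \<in> borel_measurable borel" "dy \<phi> \<in> borel_measurable borel"
    using C1_borel_measurable[OF \<phi>] by auto
  \<comment> \<open>The shear \<open>y = b(x) + s\<close> maps the quadrant onto \<open>\<Omega>\<close>, and
    \<open>\<partial>\<^sub>x\<phi> = Q - P\<close> there, with \<open>Q = d/dx \<phi>(x, b(x) + s)\<close> and \<open>P = b'(x) d/ds \<phi>(x, b(x) + s)\<close>.\<close>
  define Q where "Q = (\<lambda>z :: plane. indicator ({0<..} \<times> {0<..}) z *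
    (dx \<phi> (fst z, b (fst z) + snd z) + deriv b (fst z) * dy \<phi> (fst z, b (fst z) + snd z)))"
  define P where "P = (\<lambda>z :: plane. indicator ({0<..} \<times> {0<..}) z *
    (deriv b (fst z) * dy \<phi> (fst z, b (fst z) + snd z)))"
  \<comment> \<open>The height \<open>b x + s\<close> is at least \<open>s\<close> because
    \<open>b\<close> is nonnegative; thus \<open>Q\<close> and \<open>P\<close> vanish off the
    square with side \<open>T\<close>.\<close>
  have far': "dx \<phi> (x, b x + s) = 0 \<and> dy \<phi> (x, b x + s) = 0" if "0 < s" "T \<le> x \<or> T \<le> s" for x s
  proof -
    have "T \<le> \<bar>x\<bar> \<or> T \<le> \<bar>b x + s\<bar>" using that b_nonneg[of x] by linarith
    from far[OF this] show ?thesis by simp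
  qed
  have slope: "\<bar>deriv b x * dy \<phi> (x, y)\<bar> \<le> L * C" if "0 < x" "x \<le> T" for x y
    using slope_nonneg[of x] L(2)[OF that] that C(3)[of "(x, y)"] L(1) by (auto simp: abs_mult intro!: mult_mono)
  note bm [measurable] = borel_measurable_fst_comp borel_measurable_snd_comp
  have shear [measurable]: "(\<lambda>z. (fst z, b (fst z) + snd z)) \<in> borel \<rightarrow>\<^sub>M (borel :: plane measure)"
    by (intro borel_measurable_Pair borel_measurable_add bm) auto
  have quad [measurable]: "{0<..} \<times> {0<..} \<in> sets (borel :: plane measure)"
    by (intro borel_open open_Times) auto
  have QP [measurable]: "Q \<in> borel_measurable borel" "P \<in> borel_measurable borel"
    unfolding Q_def P_def by measurable
  have box: "bounded ({0..T} \<times> {0..T})" "{0..T} \<times> {0..T} \<in> sets (borel :: plane measure)"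
    by (auto intro!: bounded_Times borel_closed closed_Times)
  have IQ: "integrable lborel Q"
  proof (rule integrable_radon[OF radon_lborel QP(1) box, of "C + L * C"])
    show "\<bar>Q z\<bar> \<le> C + L * C" if "z \<in> {0..T} \<times> {0..T}" for z
    proof -
      obtain x s where z: "z = (x, s)" by (cases z)
      show ?thesis
        using that C(2)[of "(x, b x + s)"] slope[of x "b x + s"] T L(1)
        by (auto simp: Q_def z indicator_def intro!: order_trans[OF abs_triangle_ineq] add_mono)
    qed
    show "Q z = 0" if "z \<notin> {0..T} \<times> {0..T}" for z
      using that far'[of "snd z" "fst z"] by (cases z) (auto simp: Q_def indicator_def)
  qed
  have IP: "integrable lborel P"
  proof (rule integrable_radon[OF radon_lborel QP(2) box, of "L * C"])
    show "\<bar>P z\<bar> \<le> L * C" if "z \<in> {0..T} \<times> {0..T}" for z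
    proof -
      obtain x s where z: "z = (x, s)" by (cases z)
      show ?thesis
        using that slope[of x "b x + s"] T L(1) by (auto simp: P_def z indicator_def)
    qed
    show "P z = 0" if "z \<notin> {0..T} \<times> {0..T}" for z
      using that far'[of "snd z" "fst z"] by (cases z) (auto simp: P_def indicator_def)
  qed
  have Fub1: "(\<integral>z. f z \<partial>lborel) = (\<integral>x. (\<integral>y. f (x, y) \<partial>lborel) \<partial>lborel)"
    and Fub2: "(\<integral>z. f z \<partial>lborel) = (\<integral>y. (\<integral>x. f (x, y) \<partial>lborel) \<partial>lborel)"
    if "integrable lborel f" for f :: "plane \<Rightarrow> real"
  proof -
    have I: "integrable (lborel \<Otimes>\<^sub>M lborel) f" using that by (simp add: lborel_prod)
    show "(\<integral>z. f z \<partial>lborel) = (\<integral>x. (\<integral>y. f (x, y) \<partial>lborel) \<partial>lborel)"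
      using lborel_pair.integral_fst'[OF I] by (simp add: lborel_prod)
    show "(\<integral>z. f z \<partial>lborel) = (\<integral>y. (\<integral>x. f (x, y) \<partial>lborel) \<partial>lborel)"
      using lborel_pair.integral_snd[of "\<lambda>x y. f (x, y)"] I by (simp add: lborel_prod case_prod_unfold)
  qed
  have restrict: "(\<integral>x. indicator {0<..} x * g x \<partial>lborel) = (LINT x:{0..T}|lborel. g x)"
    if "\<And>x. T \<le> x \<Longrightarrow> g x = 0" "g \<in> borel_measurable borel" for g :: "real \<Rightarrow> real"
    unfolding set_lebesgue_integral_def
  proof (rule integral_cong_AE)
    show "AE x in lborel. indicator {0<..} x * g x = indicator {0..T} x *\<^sub>R g x"
      using AE_lborel_singleton[of "0::real"] by eventually_elim (use that(1) in \<open>auto simp: indicator_def\<close>)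
  qed (use that(2) in auto)
  have restrict': "(\<integral>x. indicator {0<..} x * g x \<partial>lborel) = (LINT x:{0..}|lborel. g x)"
    if "g \<in> borel_measurable borel" for g :: "real \<Rightarrow> real"
    unfolding set_lebesgue_integral_def
  proof (rule integral_cong_AE)
    show "AE x in lborel. indicator {0<..} x * g x = indicator {0..} x *\<^sub>R g x"
      using AE_lborel_singleton[of "0::real"] by eventually_elim (auto simp: indicator_def)
  qed (use that in auto)
  \<comment> \<open>For fixed \<open>s > 0\<close>, \<open>Q\<close> is an exact derivative in
    \<open>x\<close>, and its integral leaves only the inflow value \<open>- \<phi> (0, s)\<close>
    since \<open>b 0 = 0\<close>.\<close>
  have IntQ: "(\<integral>z. Q z \<partial>lborel) = - (LINT y:{0..}|lborel. \<phi> (0, y))"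
  proof -
    have "(\<integral>x. Q (x, s) \<partial>lborel) = indicator {0<..} s * - \<phi> (0, s)" for s
    proof (cases "0 < s")
      case True
      let ?q = "\<lambda>x. dx \<phi> (x, b x + s) + deriv b x * dy \<phi> (x, b x + s)"
      have m: "(\<lambda>x. (x, b x + s)) \<in> borel \<rightarrow>\<^sub>M (borel :: plane measure)"
        by (intro borel_measurable_Pair borel_measurable_add) auto
      have q: "?q \<in> borel_measurable borel"
        using measurable_compose[OF m, of "dx \<phi>" borel] measurable_compose[OF m, of "dy \<phi>" borel] by simp
      have "(\<integral>x. Q (x, s) \<partial>lborel) = (\<integral>x. indicator {0<..} x * ?q x \<partial>lborel)"
        using True by (intro Bochner_Integration.integral_cong) (auto simp: Q_def indicator_def)
      also have "\<dots> = (LINT x:{0..T}|lborel. ?q x)"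
        by (rule restrict) (use far'[OF True] q in auto)
      also have "\<dots> = \<phi> (T, b T + s) - \<phi> (0, b 0 + s)"
      proof (rule lborel_integral_FTC)
        show "continuous_on {0..T} (\<lambda>x. \<phi> (x, b x + s))"
          using continuous_C1_graph[OF \<phi>] by (rule continuous_on_subset) auto
        show "set_integrable lborel {0..T} ?q"
        proof (rule set_integrable_loc_bounded)
          show "loc_bounded ?q"
            unfolding loc_bounded_def
          proof (intro conjI allI q)
            fix M
            have "\<bar>?q x\<bar> \<le> C + L * C" if "0 < x" for x
            proof (cases "x \<le> T")
              case True
              then show ?thesis
                using C(2)[of "(x, b x + s)"] slope[of x "b x + s"] that
                by (intro order_trans[OF abs_triangle_ineq] add_mono) auto
            next
              case False
              then show ?thesis using far'[OF \<open>0 < s\<close>, of x] T L(1) by simp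
            qed
            then show "\<exists>C. \<forall>x. 0 < x \<and> x \<le> M \<longrightarrow> \<bar>?q x\<bar> \<le> C" by blast
          qed
        qed
      qed (use T in \<open>auto intro: C1_graph_deriv[OF \<phi>]\<close>)
      finally show ?thesis using True far[of T "b T + s"] T by (simp add: b_nonpos)
    next
      case False
      then have "Q (x, s) = 0" for x by (simp add: Q_def)
      then show ?thesis using False by simp
    qed
    then have "(\<integral>z. Q z \<partial>lborel) = (\<integral>s. - (indicator {0<..} s * \<phi> (0, s)) \<partial>lborel)"
      by (subst Fub2[OF IQ]) simp
    also have "\<dots> = - (\<integral>s. indicator {0<..} s * \<phi> (0, s) \<partial>lborel)" by simp
    also have "\<dots> = - (LINT y:{0..}|lborel. \<phi> (0, y))"
      by (subst restrict') (auto intro!: measurable_compose[of "\<lambda>y. (0, y)" borel borel \<phi>])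
    finally show ?thesis .
  qed
  \<comment> \<open>Here the inner integration is over \<open>s\<close>: the slope is constant on
    each vertical slice and comes out, and the integral of the remaining derivative leaves the wall
    value \<open>- \<phi> (x, b x)\<close>.\<close>
  have IntP: "(\<integral>z. P z \<partial>lborel) = - (LINT x:{0..}|lborel. deriv b x * \<phi> (x, b x))"
  proof -
    have "(\<integral>s. P (x, s) \<partial>lborel) = - (indicator {0<..} x * (deriv b x * \<phi> (x, b x)))" for x
    proof (cases "0 < x")
      case True
      let ?q = "\<lambda>s. dy \<phi> (x, b x + s)"
      have m: "(\<lambda>s. (x, b x + s)) \<in> borel \<rightarrow>\<^sub>M (borel :: plane measure)"
        by (intro borel_measurable_Pair borel_measurable_add) auto
      have q: "?q \<in> borel_measurable borel"
        using measurable_compose[OF m, of "dy \<phi>" borel] by simp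
      have D: "((\<lambda>s. \<phi> (x, b x + s)) has_real_derivative ?q s) (at s)" for s
      proof -
        have "((\<lambda>s. (x, b x + s)) has_derivative (\<lambda>h. (0, h))) (at s)"
          by (auto intro!: derivative_eq_intros)
        from has_derivative_compose[OF this C1_has_derivative[OF \<phi>]]
        show ?thesis by (simp add: has_field_derivative_def)
      qed
      have "(\<integral>s. P (x, s) \<partial>lborel) = (\<integral>s. deriv b x * (indicator {0<..} s * ?q s) \<partial>lborel)"
        using True by (intro Bochner_Integration.integral_cong) (auto simp: P_def indicator_def)
      also have "\<dots> = deriv b x * (\<integral>s. indicator {0<..} s * ?q s \<partial>lborel)"
        by simp
      also have "(\<integral>s. indicator {0<..} s * ?q s \<partial>lborel) = (LINT s:{0..T}|lborel. ?q s)"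
        by (rule restrict) (use far' T(1) q in auto)
      also have "\<dots> = \<phi> (x, b x + T) - \<phi> (x, b x + 0)"
        using C(3) q T(1)
        by (intro lborel_integral_FTC D set_integrable_loc_bounded)
          (auto intro: loc_boundedI[OF q C(3)] continuous_at_imp_continuous_on DERIV_isCont[OF D])
      finally show ?thesis using True far[of x "b x + T"] T(1) b_nonneg[of x] by simp
    next
      case False
      then have "P (x, s) = 0" for s by (simp add: P_def)
      then show ?thesis using False by simp
    qed
    then have "(\<integral>z. P z \<partial>lborel) = (\<integral>x. - (indicator {0<..} x * (deriv b x * \<phi> (x, b x))) \<partial>lborel)"
      by (subst Fub1[OF IP]) simp
    also have "\<dots> = - (\<integral>x. indicator {0<..} x * (deriv b x * \<phi> (x, b x)) \<partial>lborel)" by simp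
    also have "\<dots> = - (LINT x:{0..}|lborel. deriv b x * \<phi> (x, b x))"
      by (subst restrict') (auto intro!: borel_measurable_times measurable_compose[OF graph_measurable])
    finally show ?thesis .
  qed
  have box': "bounded ({-T..T} \<times> {-T..T})" "{-T..T} \<times> {-T..T} \<in> sets (borel :: plane measure)"
    by (auto intro!: bounded_Times borel_closed closed_Times)
  have Idx: "integrable lborel (\<lambda>z. indicator \<Omega> z * dx \<phi> z)"
  proof (rule integrable_radon[OF radon_lborel _ box', of _ C])
    show "\<bar>indicator \<Omega> z * dx \<phi> z\<bar> \<le> C" for z using C(2)[of z] T(2) by (simp add: indicator_def)
    show "indicator \<Omega> z * dx \<phi> z = 0" if "z \<notin> {-T..T} \<times> {-T..T}" for z
    proof -
      have "T \<le> \<bar>fst z\<bar> \<or> T \<le> \<bar>snd z\<bar>" using that by (cases z) (auto simp: abs_if split: if_splits)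
      from far[OF this] show ?thesis by simp
    qed
  qed measurable
  have "(LINT z:\<Omega>|lborel. dx \<phi> z) = (\<integral>x. (\<integral>y. indicator \<Omega> (x, y) * dx \<phi> (x, y) \<partial>lborel) \<partial>lborel)"
    using Fub1[OF Idx] by (simp add: set_lebesgue_integral_def)
  also have "\<dots> = (\<integral>x. (\<integral>s. Q (x, s) - P (x, s) \<partial>lborel) \<partial>lborel)"
  proof (rule Bochner_Integration.integral_cong[OF refl])
    fix x
    \<comment> \<open>For fixed \<open>x\<close> the shear is the translation
      \<open>y = b x + s\<close>, hence has Jacobian 1.\<close>
    show "(\<integral>y. indicator \<Omega> (x, y) * dx \<phi> (x, y) \<partial>lborel) = (\<integral>s. Q (x, s) - P (x, s) \<partial>lborel)"
      by (subst lborel_integral_real_affine[where c=1 and t="b x"])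
        (auto simp: Q_def P_def ramp_domain_def indicator_def intro!: Bochner_Integration.integral_cong)
  qed
  also have "\<dots> = (\<integral>z. Q z - P z \<partial>lborel)" using IQ IP by (subst Fub1) auto
  also have "\<dots> = (\<integral>z. Q z \<partial>lborel) - (\<integral>z. P z \<partial>lborel)" using IQ IP by simp
  finally show ?thesis by (simp add: IntQ IntP)
qed

end

text \<open>Reduces the definition to ordinary integrals against \<open>R\<close>. Since
  \<open>u\<close>, \<open>v\<close>, \<open>E\<close> are nonnegative and bounded, the fluxes are
  iterated densities with zero negative part; they are Radon, and the conditions on absolute
  continuity and derivatives hold by construction. What remains are the four balances, the vacuum
  convention and the entropy condition.\<close>

lemma measure_solution_pressurelessI:
  fixes u v E :: "plane \<Rightarrow> real"
  assumes R: "radon_measure R" "concentrated_on (closure (ramp_domain b)) (signed_of R)"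
    and u: "u \<in> borel_measurable borel" "\<And>z. 0 \<le> u z" "\<And>z. u z \<le> C\<^sub>u"
    and v: "v \<in> borel_measurable borel" "\<And>z. 0 \<le> v z" "\<And>z. v z \<le> C\<^sub>v"
    and E: "E \<in> borel_measurable borel" "\<And>z. 0 \<le> E z" "\<And>z. E z \<le> C\<^sub>E"
    and w: "\<And>x. 0 \<le> x \<Longrightarrow> 0 \<le> w x" "\<And>T. set_integrable lborel {0..T} w"
    and mass: "\<And>\<phi>. C1_compact_support \<phi> \<Longrightarrow>
      (\<integral>z. u z * dx \<phi> z \<partial>R) + (\<integral>z. v z * dy \<phi> z \<partial>R)
        + (LINT y:{0..}|lborel. \<rho>\<^sub>0 * u\<^sub>0 * \<phi> (0, y)) = 0"
    and momentum1: "\<And>\<phi>. C1_compact_support \<phi> \<Longrightarrow>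
      (\<integral>z. u z * u z * dx \<phi> z \<partial>R) + (\<integral>z. v z * u z * dy \<phi> z \<partial>R)
        + wall_pairing b (\<lambda>x. w x * normal1 b x) \<phi>
        + (LINT y:{0..}|lborel. \<rho>\<^sub>0 * u\<^sub>0\<^sup>2 * \<phi> (0, y)) = 0"
    and momentum2: "\<And>\<phi>. C1_compact_support \<phi> \<Longrightarrow>
      (\<integral>z. u z * v z * dx \<phi> z \<partial>R) + (\<integral>z. v z * v z * dy \<phi> z \<partial>R)
        + wall_pairing b (\<lambda>x. w x * normal2 b x) \<phi>
        + (LINT y:{0..}|lborel. \<rho>\<^sub>0 * u\<^sub>0 * v\<^sub>0 * \<phi> (0, y)) = 0"
    and energy: "\<And>\<phi>. C1_compact_support \<phi> \<Longrightarrow>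
      (\<integral>z. u z * E z * dx \<phi> z \<partial>R) + (\<integral>z. v z * E z * dy \<phi> z \<partial>R)
        + (LINT y:{0..}|lborel. \<rho>\<^sub>0 * u\<^sub>0 * E\<^sub>0 * \<phi> (0, y)) = 0"
    and vacuum: "\<And>N z. open N \<Longrightarrow> emeasure R N = 0 \<Longrightarrow> z \<in> N \<Longrightarrow> u z = 0 \<and> v z = 0 \<and> E z = 0"
    and entropy: "\<And>A \<rho>. A \<in> sets borel \<Longrightarrow> A \<subseteq> closure (ramp_domain b) \<Longrightarrow>
      is_RN_deriv_on A \<rho> (signed_of R) (signed_of lborel) \<Longrightarrow> entropy_condition_on A \<rho> u v E"
  shows "measure_solution 1 b \<rho>\<^sub>0 u\<^sub>0 v\<^sub>0 E\<^sub>0 R u v E w"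
proof -
  let ?S = "closure (ramp_domain b)"
  define D where "D M f = density M (\<lambda>z. ennreal (f z))" for M :: "plane measure" and f :: "plane \<Rightarrow> real"
  define m where "m = (\<lambda>i::nat. if i = 0 then signed_of (D R u) else if i = 1 then signed_of (D (D R u) u)
    else if i = 2 then signed_of (D (D R u) v) else signed_of (D (D R u) E))"
  define n where "n = (\<lambda>i::nat. if i = 0 then signed_of (D R v) else if i = 1 then signed_of (D (D R v) u)
    else if i = 2 then signed_of (D (D R v) v) else signed_of (D (D R v) E))"
  define P :: signed_measure where "P = signed_of (null_measure borel)"
  have m: "m 0 = signed_of (D R u)" "m 1 = signed_of (D (D R u) u)"
    "m 2 = signed_of (D (D R u) v)" "m 3 = signed_of (D (D R u) E)"
    and n: "n 0 = signed_of (D R v)" "n 1 = signed_of (D (D R v) u)"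
    "n 2 = signed_of (D (D R v) v)" "n 3 = signed_of (D (D R v) E)"
    by (simp_all add: m_def n_def)
  have S: "- ?S \<in> sets borel" by (intro borel_open open_Compl closed_closure)
  have radon: "radon_measure (D M u)" "radon_measure (D M v)" "radon_measure (D M E)" if "radon_measure M" for M
    unfolding D_def using that u(1,3) v(1,3) E(1,3) by (blast intro: radon_density)+
  have conc: "concentrated_on ?S (signed_of (D M f))"
    if "radon_measure M" "concentrated_on ?S (signed_of M)" "f \<in> borel_measurable borel" for M f
    unfolding D_def using that radon_measureD[OF that(1)] S by (intro concentrated_on_density) auto
  have ac: "signed_of (D M f) \<lless> signed_of M" if "radon_measure M" "f \<in> borel_measurable borel" for M f
    unfolding D_def using that radon_measureD[OF that(1)] by (intro abs_cont_density) auto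
  have RN: "is_RN_deriv u (signed_of (D M u)) (signed_of M)" "is_RN_deriv v (signed_of (D M v)) (signed_of M)"
    "is_RN_deriv E (signed_of (D M E)) (signed_of M)" if "radon_measure M" for M
    unfolding D_def using that u v E by (blast intro: is_RN_deriv_density)+
  have int: "(\<integral>z. \<psi> z \<partial>D M f) = (\<integral>z. f z * \<psi> z \<partial>M)"
    if "radon_measure M" "f \<in> borel_measurable borel" "\<And>z. 0 \<le> f z" "\<psi> \<in> borel_measurable borel" for M f \<psi>
    unfolding D_def using that radon_measureD[OF that(1)] by (subst integral_density) auto
  have int2: "(\<integral>z. \<psi> z \<partial>D (D R f) g) = (\<integral>z. f z * g z * \<psi> z \<partial>R)"
    if "f \<in> borel_measurable borel" "\<And>z. 0 \<le> f z" "radon_measure (D R f)"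
      "g \<in> borel_measurable borel" "\<And>z. 0 \<le> g z" "\<psi> \<in> borel_measurable borel" for f g \<psi>
    using that R(1) by (simp add: int mult.assoc)
  have weak: "weak_euler b \<rho>\<^sub>0 u\<^sub>0 v\<^sub>0 E\<^sub>0 (state_pressure 1 \<rho>\<^sub>0 u\<^sub>0 v\<^sub>0 E\<^sub>0) m n P w"
    unfolding weak_euler_def
  proof (intro allI impI)
    fix \<phi> assume \<phi>: "C1_compact_support \<phi>"
    note meas = C1_borel_measurable[OF \<phi>]
    note ints = int[OF R(1) u(1,2) meas(2)] int[OF R(1) v(1,2) meas(3)]
      int2[OF u(1,2) radon(1)[OF R(1)] _ _ meas(2)] int2[OF v(1,2) radon(2)[OF R(1)] _ _ meas(3)]
    show "pairing (m 0) (dx \<phi>) + pairing (n 0) (dy \<phi>)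
          + (LINT y:{0..}|lborel. \<rho>\<^sub>0 * u\<^sub>0 * \<phi> (0, y)) = 0 \<and>
        pairing (m 1) (dx \<phi>) + pairing (n 1) (dy \<phi>) + pairing P (dx \<phi>)
          + wall_pairing b (\<lambda>x. w x * normal1 b x) \<phi>
          + (LINT y:{0..}|lborel. (\<rho>\<^sub>0 * u\<^sub>0\<^sup>2 + state_pressure 1 \<rho>\<^sub>0 u\<^sub>0 v\<^sub>0 E\<^sub>0) * \<phi> (0, y)) = 0 \<and>
        pairing (m 2) (dx \<phi>) + pairing (n 2) (dy \<phi>) + pairing P (dy \<phi>)
          + wall_pairing b (\<lambda>x. w x * normal2 b x) \<phi>
          + (LINT y:{0..}|lborel. \<rho>\<^sub>0 * u\<^sub>0 * v\<^sub>0 * \<phi> (0, y)) = 0 \<and>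
        pairing (m 3) (dx \<phi>) + pairing (n 3) (dy \<phi>)
          + (LINT y:{0..}|lborel. \<rho>\<^sub>0 * u\<^sub>0 * E\<^sub>0 * \<phi> (0, y)) = 0"
      unfolding m n P_def pairing_signed_of ints ints(3,4)[OF u(1,2)] ints(3,4)[OF v(1,2)] ints(3,4)[OF E(1,2)]
      using mass[OF \<phi>] momentum1[OF \<phi>] momentum2[OF \<phi>] energy[OF \<phi>]
      by (simp add: state_pressure_def)
  qed
  \<comment> \<open>For \<gamma> = 1 the state pressure is identically 0. The zero function is also
    a density of \<open>P\<close>, so uniqueness makes every other density \<open>p\<close> vanish
    almost everywhere in \<open>A\<close>.\<close>
  have P: "AE z in lborel. z \<in> A \<longrightarrow> p z = state_pressure 1 (\<rho> z) (u z) (v z) (E z)"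
    if "A \<in> sets borel" "is_RN_deriv_on A p P (signed_of lborel)" for A p \<rho>
  proof -
    have "is_RN_deriv_on A (\<lambda>_. 0) P (signed_of lborel)"
      by (simp add: is_RN_deriv_on_def P_def set_integrable_def set_lebesgue_integral_def)
    from is_RN_deriv_on_lborel_unique[OF that(2) this that(1)] show ?thesis by (simp add: state_pressure_def)
  qed
  note rad = radon[OF R(1)]
  have radon_null: "radon_measure (null_measure borel :: plane measure)" by (simp add: radon_measure_def)
  have mn: "\<forall>i \<in> {0, 1, 2, 3}. signed_radon_measure (m i) \<and> signed_radon_measure (n i) \<and>
      concentrated_on ?S (m i) \<and> concentrated_on ?S (n i)"
    using rad radon[OF rad(1)] radon[OF rad(2)] R u(1) v(1) E(1)
    by (simp add: m n conc signed_radon_measure_signed_of del: One_nat_def)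
  have P0: "signed_radon_measure P" "concentrated_on ?S P" "P \<lless> signed_of R"
    using radon_measureD[OF R(1)] radon_null
    by (auto simp: P_def signed_radon_measure_signed_of concentrated_on_def abs_cont_def null_sets_def)
  have ac_mn: "m 0 \<lless> signed_of R" "n 0 \<lless> signed_of R" "\<forall>k \<in> {1, 2, 3}. m k \<lless> m 0 \<and> n k \<lless> n 0"
    using rad R(1) u(1) v(1) E(1) by (simp_all add: m n ac del: One_nat_def)
  have RN_mn: "is_RN_deriv u (m 0) (signed_of R)" "is_RN_deriv v (n 0) (signed_of R)"
    "is_RN_deriv u (m 1) (m 0)" "is_RN_deriv u (n 1) (n 0)"
    "is_RN_deriv v (m 2) (m 0)" "is_RN_deriv v (n 2) (n 0)"
    "is_RN_deriv E (m 3) (m 0)" "is_RN_deriv E (n 3) (n 0)"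
    unfolding m n by (rule RN R(1) rad)+
  have w': "\<forall>x \<ge> 0. 0 \<le> w x" "\<forall>T. set_integrable lborel {0..T} w"
    using w by auto
  have vac': "\<forall>N. open N \<and> emeasure R N = 0 \<longrightarrow> (\<forall>z \<in> N. u z = 0 \<and> v z = 0 \<and> E z = 0)"
    using vacuum by blast
  have state: "\<forall>A \<in> sets borel. \<forall>\<rho> p. A \<subseteq> ?S \<and> is_RN_deriv_on A \<rho> (signed_of R) (signed_of lborel) \<and>
      is_RN_deriv_on A p P (signed_of lborel) \<longrightarrow>
        (AE z in lborel. z \<in> A \<longrightarrow> p z = state_pressure 1 (\<rho> z) (u z) (v z) (E z)) \<and>
        entropy_condition_on A \<rho> u v E"
    using P entropy by blast
  show ?thesis
    unfolding measure_solution_def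
    by (intro exI[of _ m] exI[of _ n] exI[of _ P] conjI)
      (fact mn P0 w' weak R ac_mn RN_mn vac' state)+
qed

section \<open>Momentum balance along the wall\<close>

context ramp
begin

text \<open>\<open>K\<close> and \<open>G\<close> are the two components of the momentum flux along
  the wall: \<open>H\<close> times the unit tangent \<open>(1, deriv b x) / speed x\<close>.\<close>

abbreviation "G x \<equiv> deriv b x * H x / speed x"
abbreviation "K x \<equiv> H x / speed x"

lemma speed_deriv:
  assumes "0 < x"
  shows "(speed has_real_derivative deriv b x * deriv (deriv b) x / speed x) (at x)"
proof -
  have D: "((\<lambda>x. 1 + (deriv b x)\<^sup>2) has_real_derivative 2 * deriv b x * deriv (deriv b) x) (at x)"
    using slope_deriv[OF assms] by (auto intro!: derivative_eq_intros)
  have "0 < 1 + (deriv b x)\<^sup>2" by (simp add: add_pos_nonneg)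
  from DERIV_chain2[OF DERIV_real_sqrt[OF this] D] show ?thesis
    by (rule DERIV_cong) (simp add: field_simps)
qed

lemma powr_speed: "(1 + (deriv b x)\<^sup>2) powr (3 / 2) = speed x ^ 3"
proof -
  have *: "speed x = (1 + (deriv b x)\<^sup>2) powr (1 / 2)" by (simp add: powr_half_sqrt)
  have "speed x ^ 3 = speed x powr 3" by (simp add: powr_numeral[OF less_imp_le[OF speed_pos]])
  also have "\<dots> = (1 + (deriv b x)\<^sup>2) powr (3 / 2)" by (subst *) (simp add: powr_powr)
  finally show ?thesis by simp
qed

text \<open>For \<open>x > 0\<close> the hypothesis on the second derivative says that the numerator
  is positive. At 0 the unknown second derivative is multiplied by \<open>H 0 = 0\<close>, and a
  square remains.\<close>

lemma weight_nonneg: "0 \<le> x \<Longrightarrow> 0 \<le> weight x"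
  using weight_ineq[of x] H_nonpos[of 0] by (cases "x = 0") auto

lemma G_deriv:
  assumes "0 < x"
  shows "(G has_real_derivative weight x) (at x)"
proof -
  have S: "speed x * speed x = 1 + deriv b x * deriv b x" using speed_sq[of x] by (simp add: power2_eq_square)
  \<comment> \<open>\<open>p\<close>, \<open>q\<close>, \<open>h\<close>, \<open>s\<close> stand for
    slope, second derivative, \<open>H\<close> and speed; the left side is the output of the
    quotient rule.\<close>
  have alg: "((q * h + p / s * p) * s - p * h * (p * q / s)) / (s * s) = (q * h + p\<^sup>2 * s) / s ^ 3"
    if "0 < s" "s * s = 1 + p * p" for p q h s :: real
    using that by (simp add: divide_simps power2_eq_square power3_eq_cube) algebra
  show ?thesis
    unfolding powr_speed
    using DERIV_divide[OF DERIV_mult[OF slope_deriv[OF assms] H_deriv[OF assms]] speed_deriv[OF assms]]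
      alg[OF speed_pos S, of "deriv (deriv b) x" "H x"] speed_pos[of x]
    by (simp add: mult_ac)
qed

text \<open>Together with \<open>G_deriv\<close> this gives K' + b' G' = b', the tangential balance:
  the wall force \<open>weight x\<close> times (-b', 1) drops out along (1, b').\<close>

lemma K_deriv:
  assumes "0 < x"
  shows "(K has_real_derivative deriv b x - weight x * deriv b x) (at x)"
proof -
  have S: "speed x * speed x = 1 + deriv b x * deriv b x" using speed_sq[of x] by (simp add: power2_eq_square)
  have alg: "(p / s * s - h * (p * q / s)) / (s * s) = p - (q * h + p\<^sup>2 * s) / s ^ 3 * p"
    if "0 < s" "s * s = 1 + p * p" for p q h s :: real
  proof -
    have "p * s - h * (p * q) = p * s ^ 3 - (q * h + p\<^sup>2 * s) * p"
      using that(2) by algebra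
    then show ?thesis using that(1) by (simp add: field_simps power3_eq_cube)
  qed
  show ?thesis
    unfolding powr_speed
    using DERIV_divide[OF H_deriv[OF assms] speed_deriv[OF assms]]
      alg[OF speed_pos S, of "H x" "deriv (deriv b) x"] speed_pos[of x]
    by (simp add: mult_ac)
qed

text \<open>\<open>G\<close> and \<open>K\<close> involve the slope, which need not have a limit at
  0. Continuity there is forced by squeezing, because \<open>H\<close> is continuous and vanishes
  for \<open>x \<le> 0\<close>.\<close>

lemma continuous_dominated_by_H:
  assumes "\<And>x. 0 < x \<Longrightarrow> (f has_real_derivative f' x) (at x)" "\<And>x. \<bar>f x\<bar> \<le> \<bar>H x\<bar>"
  shows "continuous_on UNIV f"
proof -
  have "isCont f x" for x
  proof (cases "0 < x")
    case True
    then show ?thesis using assms(1) by (blast intro: DERIV_isCont)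
  next
    case False
    then have 0: "H x = 0" by (simp add: H_nonpos)
    have "isCont H x" using continuous_H by (simp add: continuous_on_eq_continuous_at)
    then have "(H \<longlongrightarrow> 0) (at x)" by (simp add: isCont_def 0)
    then have "((\<lambda>x. \<bar>H x\<bar>) \<longlongrightarrow> 0) (at x)" by (rule tendsto_rabs_zero)
    then have "(f \<longlongrightarrow> 0) (at x)" by (rule Lim_null_comparison[rotated]) (simp add: assms(2))
    moreover have "f x = 0" using assms(2)[of x] 0 by simp
    ultimately show ?thesis by (simp add: isCont_def)
  qed
  then show ?thesis by (simp add: continuous_at_imp_continuous_on)
qed

lemma continuous_G: "continuous_on UNIV G"
proof (rule continuous_dominated_by_H[OF G_deriv])
  show "\<bar>G x\<bar> \<le> \<bar>H x\<bar>" for x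
    using mult_left_le[OF slope_div_speed[of x], of "\<bar>H x\<bar>"] by (simp add: abs_mult abs_divide mult.commute)
qed

lemma continuous_K: "continuous_on UNIV K"
proof (rule continuous_dominated_by_H[OF K_deriv])
  show "\<bar>K x\<bar> \<le> \<bar>H x\<bar>" for x
    using speed_ge_1[of x] speed_pos[of x] mult_left_mono[OF speed_ge_1[of x], of "\<bar>H x\<bar>"]
    by (simp add: abs_divide divide_le_eq)
qed

text \<open>The second derivative may blow up at 0, so no bound on \<open>weight\<close> is at hand.
  But \<open>weight\<close> is nonnegative and is the derivative of the continuous function
  \<open>G\<close>, hence its integral over \<open>{0..T}\<close> is the finite increment of
  \<open>G\<close>.\<close>

lemma weight_integrable: "set_integrable lborel {0..T} weight"
proof (cases "0 \<le> T")
  case True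
  have "(weight has_integral (G T - G 0)) {0..T}"
    using G_deriv
    by (intro fundamental_theorem_of_calculus_interior True continuous_on_subset[OF continuous_G])
      (auto simp: has_real_derivative_iff_has_vector_derivative)
  then have "weight absolutely_integrable_on {0..T}"
    using weight_nonneg by (intro nonnegative_absolutely_integrable_1) (auto simp: integrable_on_def)
  \<comment> \<open>Absolute integrability refers to the completed measure; Borel measurability of
    \<open>weight\<close> carries it back to \<open>lborel\<close>.\<close>
  then show ?thesis
    unfolding set_integrable_def by (subst (asm) integrable_completion) auto
qed (simp add: set_integrable_def)

text \<open>The flux \<open>(g, deriv b * g)\<close> is tangent to the wall, so the two integrals on
  the left combine to \<open>g\<close> times the derivative of \<open>\<phi>\<close> along the wall.
  Integrating the derivative of \<open>g x * \<phi> (x, b x)\<close> leaves no boundary terms: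
  \<open>g\<close> vanishes at 0 and \<open>\<phi>\<close> at \<open>T\<close>. It is applied with
  \<open>g\<close> equal to \<open>b\<close>, \<open>K\<close> and \<open>G\<close>.\<close>

lemma wall_by_parts:
  assumes \<phi>: "C1_compact_support \<phi>" and T: "0 < T" "\<And>y. \<phi> (T, y) = 0"
    and C: "\<And>z. \<bar>dx \<phi> z\<bar> \<le> C" "\<And>z. \<bar>dy \<phi> z\<bar> \<le> C"
    and g: "continuous_on UNIV g" "g 0 = 0" "\<And>x. 0 < x \<Longrightarrow> (g has_real_derivative g' x) (at x)"
    and I: "set_integrable lborel {0..T} g'"
  shows "(LINT x:{0..T}|lborel. g x * dx \<phi> (x, b x)) + (LINT x:{0..T}|lborel. deriv b x * g x * dy \<phi> (x, b x)) =
    - (LINT x:{0..T}|lborel. g' x * \<phi> (x, b x))"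
proof -
  have [measurable]: "dx \<phi> \<in> borel_measurable borel" "dy \<phi> \<in> borel_measurable borel"
    using C1_borel_measurable[OF \<phi>] by auto
  have "(\<lambda>x. dx \<phi> (x, b x)) \<in> borel_measurable borel" "(\<lambda>x. dy \<phi> (x, b x)) \<in> borel_measurable borel"
    by (auto intro!: measurable_compose[OF graph_measurable])
  from loc_boundedI[OF this(1) C(1)] loc_boundedI[OF this(2) C(2)]
  have lb: "loc_bounded (\<lambda>x. dx \<phi> (x, b x))" "loc_bounded (\<lambda>x. dy \<phi> (x, b x))"
    by this
  have cont: "continuous_on UNIV (\<lambda>x. \<phi> (x, b x))"
    using continuous_C1_graph[OF \<phi>, of 0] by simp
  have I1: "set_integrable lborel {0..T} (\<lambda>x. g x * dx \<phi> (x, b x))"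
    by (intro set_integrable_loc_bounded loc_bounded_mult lb loc_bounded_continuous g)
  have I2: "set_integrable lborel {0..T} (\<lambda>x. deriv b x * g x * dy \<phi> (x, b x))"
    by (intro set_integrable_loc_bounded loc_bounded_mult lb loc_bounded_continuous g slope_loc_bounded)
  have I3: "set_integrable lborel {0..T} (\<lambda>x. g' x * \<phi> (x, b x))"
    by (intro set_integrable_mult_loc_bounded I loc_bounded_continuous cont)
  have I12: "set_integrable lborel {0..T} (\<lambda>x. g x * dx \<phi> (x, b x) + deriv b x * g x * dy \<phi> (x, b x))"
    by (intro set_integral_add I1 I2)
  have "(LINT x:{0..T}|lborel. (g x * dx \<phi> (x, b x) + deriv b x * g x * dy \<phi> (x, b x)) + g' x * \<phi> (x, b x)) =
      g T * \<phi> (T, b T) - g 0 * \<phi> (0, b 0)"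
  proof (rule lborel_integral_FTC)
    show "continuous_on {0..T} (\<lambda>x. g x * \<phi> (x, b x))"
      by (intro continuous_on_mult continuous_on_subset[OF g(1)] continuous_on_subset[OF cont]) auto
    show "set_integrable lborel {0..T}
        (\<lambda>x. (g x * dx \<phi> (x, b x) + deriv b x * g x * dy \<phi> (x, b x)) + g' x * \<phi> (x, b x))"
      by (intro set_integral_add I12 I3)
    show "((\<lambda>x. g x * \<phi> (x, b x)) has_real_derivative
        (g x * dx \<phi> (x, b x) + deriv b x * g x * dy \<phi> (x, b x)) + g' x * \<phi> (x, b x)) (at x)" if "0 < x" for x
      using DERIV_mult[OF g(3)[OF that] C1_graph_deriv[OF \<phi> that, of 0]] by (simp add: algebra_simps)
  qed (use T in auto)
  then show ?thesis
    using set_integral_add(2)[OF I12 I3] set_integral_add(2)[OF I1 I2] by (simp add: g(2) T(2))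
qed


section \<open>The measure solution\<close>

text \<open>\<open>c\<close> is the constant value of the state quantity \<open>q\<close> in the
  domain; \<open>k\<close> is the density on the wall of \<open>q\<close> times \<open>R\<close>
  with respect to \<open>x\<close>, arc length included.\<close>

lemma integral_R_profile:
  fixes q \<psi> :: "plane \<Rightarrow> real"
  assumes q: "q \<in> borel_measurable borel" "\<And>z. \<bar>q z\<bar> \<le> B"
    and c: "\<And>z. z \<in> \<Omega> \<Longrightarrow> q z = c"
    and k: "\<And>x. 0 \<le> x \<Longrightarrow> q (x, b x) * (wall_density x * speed x) = k x"
    and \<psi>: "\<psi> \<in> borel_measurable borel" "\<And>z. \<bar>\<psi> z\<bar> \<le> C" "\<And>x y. T \<le> \<bar>x\<bar> \<or> T \<le> \<bar>y\<bar> \<Longrightarrow> \<psi> (x, y) = 0"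
  shows "(\<integral>z. q z * \<psi> z \<partial>R) = c * (LINT z:\<Omega>|lborel. \<psi> z) + (LINT x:{0..T}|lborel. k x * \<psi> (x, b x))"
proof -
  have "0 \<le> B" using q(2)[of 0] by linarith
  then have "\<bar>q z * \<psi> z\<bar> \<le> B * C" for z
    using q(2)[of z] \<psi>(2)[of z] by (auto simp: abs_mult intro!: mult_mono)
  then have "(\<integral>z. q z * \<psi> z \<partial>R) = (LINT z:\<Omega>|lborel. q z * \<psi> z) +
      (LINT x:{0..T}|lborel. q (x, b x) * \<psi> (x, b x) * (wall_density x * speed x))"
    using q(1) \<psi>(1,3) by (intro integral_R) auto
  also have "(LINT z:\<Omega>|lborel. q z * \<psi> z) = (LINT z:\<Omega>|lborel. c * \<psi> z)"
    using c by (intro set_lebesgue_integral_cong) auto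
  also have "(LINT x:{0..T}|lborel. q (x, b x) * \<psi> (x, b x) * (wall_density x * speed x)) =
      (LINT x:{0..T}|lborel. k x * \<psi> (x, b x))"
    by (intro set_lebesgue_integral_cong) (auto simp: k[symmetric])
  finally show ?thesis by simp
qed

text \<open>For \<open>x > 0\<close> these are cancellations of positive quantities. At
  \<open>x = 0\<close> both sides are 0, because \<open>b 0 = H 0 = 0\<close> and division by 0
  yields 0.\<close>

lemma wall_profiles:
  assumes "0 \<le> x"
  shows "H x / (b x * speed x) * (wall_density x * speed x) = b x"
    and "deriv b x * H x / (b x * speed x) * (wall_density x * speed x) = deriv b x * b x"
    and "H x / (b x * speed x) * (H x / (b x * speed x)) * (wall_density x * speed x) = K x"
    and "deriv b x * H x / (b x * speed x) * (H x / (b x * speed x)) * (wall_density x * speed x) = deriv b x * K x"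
    and "deriv b x * H x / (b x * speed x) * (deriv b x * H x / (b x * speed x)) * (wall_density x * speed x) =
      deriv b x * G x"
    and "H x / (b x * speed x) * (deriv b x * H x / (b x * speed x)) * (wall_density x * speed x) = G x"
proof -
  have *: "h / (B * s) * (B\<^sup>2 / h * s) = B" "p * h / (B * s) * (B\<^sup>2 / h * s) = p * B"
    "h / (B * s) * (h / (B * s)) * (B\<^sup>2 / h * s) = h / s"
    "p * h / (B * s) * (h / (B * s)) * (B\<^sup>2 / h * s) = p * (h / s)"
    "p * h / (B * s) * (p * h / (B * s)) * (B\<^sup>2 / h * s) = p * (p * h / s)"
    "h / (B * s) * (p * h / (B * s)) * (B\<^sup>2 / h * s) = p * h / s"
    if "B = 0 \<and> h = 0 \<or> 0 < B \<and> 0 < h" "0 < s" for B h s p :: real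
    using that by (auto simp: field_simps power2_eq_square)
  have "b x = 0 \<and> H x = 0 \<or> 0 < b x \<and> 0 < H x"
    using assms b_pos[of x] H_pos[of x] b_nonpos[of x] H_nonpos[of x] by (cases "x = 0") auto
  from *[OF this speed_pos]
  show "H x / (b x * speed x) * (wall_density x * speed x) = b x"
    and "deriv b x * H x / (b x * speed x) * (wall_density x * speed x) = deriv b x * b x"
    and "H x / (b x * speed x) * (H x / (b x * speed x)) * (wall_density x * speed x) = K x"
    and "deriv b x * H x / (b x * speed x) * (H x / (b x * speed x)) * (wall_density x * speed x) = deriv b x * K x"
    and "deriv b x * H x / (b x * speed x) * (deriv b x * H x / (b x * speed x)) * (wall_density x * speed x) =
      deriv b x * G x"
    and "H x / (b x * speed x) * (deriv b x * H x / (b x * speed x)) * (wall_density x * speed x) = G x"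
    by this+
qed

lemma weak_formulation:
  assumes \<phi>: "C1_compact_support \<phi>"
  shows "(\<integral>z. U z * dx \<phi> z \<partial>R) + (\<integral>z. V z * dy \<phi> z \<partial>R) + (LINT y:{0..}|lborel. \<phi> (0, y)) = 0" (is ?mass)
    and "(\<integral>z. U z * U z * dx \<phi> z \<partial>R) + (\<integral>z. V z * U z * dy \<phi> z \<partial>R)
        + wall_pairing b (\<lambda>x. weight x * normal1 b x) \<phi> + (LINT y:{0..}|lborel. \<phi> (0, y)) = 0" (is ?mom1)
    and "(\<integral>z. U z * V z * dx \<phi> z \<partial>R) + (\<integral>z. V z * V z * dy \<phi> z \<partial>R)
        + wall_pairing b (\<lambda>x. weight x * normal2 b x) \<phi> = 0" (is ?mom2)
proof -
  obtain T C where T: "0 < T" "0 \<le> C"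
    and C: "\<And>z. \<bar>\<phi> z\<bar> \<le> C" "\<And>z. \<bar>dx \<phi> z\<bar> \<le> C" "\<And>z. \<bar>dy \<phi> z\<bar> \<le> C"
    and far: "\<And>x y. T \<le> \<bar>x\<bar> \<or> T \<le> \<bar>y\<bar> \<Longrightarrow> \<phi> (x, y) = 0 \<and> dx \<phi> (x, y) = 0 \<and> dy \<phi> (x, y) = 0"
    using C1_compact_support_bounds[OF \<phi>] by metis
  note meas = C1_borel_measurable[OF \<phi>]
  have T0: "\<phi> (T, y) = 0" for y using far[of T y] T(1) by simp
  note parts = wall_by_parts[OF \<phi> T(1) T0 C(2,3)]
  have abs: "\<bar>U z\<bar> \<le> 1" "\<bar>V z\<bar> \<le> 1" "\<bar>U z * U z\<bar> \<le> 1" "\<bar>V z * U z\<bar> \<le> 1" "\<bar>U z * V z\<bar> \<le> 1" "\<bar>V z * V z\<bar> \<le> 1" for z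
    using U_bounds[of z] V_bounds[of z] by (simp_all only: abs_mult abs_of_nonneg mult_le_one)
  note [measurable] = borel_U borel_V
  have UV: "(\<lambda>z. U z * U z) \<in> borel_measurable borel" "(\<lambda>z. V z * U z) \<in> borel_measurable borel"
    "(\<lambda>z. U z * V z) \<in> borel_measurable borel" "(\<lambda>z. V z * V z) \<in> borel_measurable borel"
    by (intro borel_measurable_times borel_U borel_V)+
  let ?X = "LINT z:\<Omega>|lborel. dx \<phi> z"
  let ?I = "\<lambda>f. LINT x:{0..T}|lborel. f x * \<phi> (x, b x)"
  have dxf: "T \<le> \<bar>x\<bar> \<or> T \<le> \<bar>y\<bar> \<Longrightarrow> dx \<phi> (x, y) = 0" "T \<le> \<bar>x\<bar> \<or> T \<le> \<bar>y\<bar> \<Longrightarrow> dy \<phi> (x, y) = 0" for x y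
    using far by blast+
  \<comment> \<open>The factors 1 and 0 in this and the next five identities are the values of
    \<open>U\<close>, \<open>V\<close> and their products in \<open>\<Omega>\<close>; they stay
    unsimplified so as to match \<open>balance\<close>.\<close>
  have mU: "(\<integral>z. U z * dx \<phi> z \<partial>R) = 1 * ?X + (LINT x:{0..T}|lborel. b x * dx \<phi> (x, b x))"
    by (rule integral_R_profile[OF borel_U abs(1) U_domain _ meas(2) C(2) dxf(1)])
      (simp_all only: U_wall wall_profiles)
  have mV: "(\<integral>z. V z * dy \<phi> z \<partial>R) = 0 * (LINT z:\<Omega>|lborel. dy \<phi> z) + (LINT x:{0..T}|lborel. deriv b x * b x * dy \<phi> (x, b x))"
    by (rule integral_R_profile[OF borel_V abs(2) V_domain _ meas(3) C(3) dxf(2)])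
      (simp_all only: V_wall wall_profiles)
  have mUU: "(\<integral>z. U z * U z * dx \<phi> z \<partial>R) = 1 * ?X + (LINT x:{0..T}|lborel. K x * dx \<phi> (x, b x))"
    by (rule integral_R_profile[OF UV(1) abs(3) _ _ meas(2) C(2) dxf(1)])
      (simp_all only: U_domain U_wall wall_profiles mult_1)
  have mVU: "(\<integral>z. V z * U z * dy \<phi> z \<partial>R) = 0 * (LINT z:\<Omega>|lborel. dy \<phi> z) + (LINT x:{0..T}|lborel. deriv b x * K x * dy \<phi> (x, b x))"
    by (rule integral_R_profile[OF UV(2) abs(4) _ _ meas(3) C(3) dxf(2)])
      (simp_all only: V_domain U_wall V_wall wall_profiles mult_zero_left)
  have mUV: "(\<integral>z. U z * V z * dx \<phi> z \<partial>R) = 0 * ?X + (LINT x:{0..T}|lborel. G x * dx \<phi> (x, b x))"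
    by (rule integral_R_profile[OF UV(3) abs(5) _ _ meas(2) C(2) dxf(1)])
      (simp_all only: V_domain U_wall V_wall wall_profiles mult_zero_right)
  have mVV: "(\<integral>z. V z * V z * dy \<phi> z \<partial>R) = 0 * (LINT z:\<Omega>|lborel. dy \<phi> z) + (LINT x:{0..T}|lborel. deriv b x * G x * dy \<phi> (x, b x))"
    by (rule integral_R_profile[OF UV(4) abs(6) _ _ meas(3) C(3) dxf(2)])
      (simp_all only: V_domain V_wall wall_profiles mult_zero_left)
  have X: "?X = ?I (deriv b) - (LINT y:{0..}|lborel. \<phi> (0, y))"
  proof -
    have "(LINT x:{0..}|lborel. deriv b x * \<phi> (x, b x)) = ?I (deriv b)"
      unfolding set_lebesgue_integral_def using far
      by (intro Bochner_Integration.integral_cong) (auto simp: indicator_def)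
    then show ?thesis by (simp add: integral_x_derivative_domain[OF \<phi>])
  qed
  have I_slope: "set_integrable lborel {0..T} (deriv b)"
    by (intro set_integrable_loc_bounded slope_loc_bounded)
  have I_weight_slope: "set_integrable lborel {0..T} (\<lambda>x. weight x * deriv b x)"
    by (intro set_integrable_mult_loc_bounded weight_integrable slope_loc_bounded)
  have \<phi>_graph: "loc_bounded (\<lambda>x. \<phi> (x, b x))"
    using continuous_C1_graph[OF \<phi>, of 0] by (intro loc_bounded_continuous) simp
  have wall: "wall_pairing b w \<phi> = (LINT x:{0..T}|lborel. w x * speed x * \<phi> (x, b x))" for w
    unfolding curve_pairing_def param_domain_infinity curve_speed_graph set_lebesgue_integral_def
    using far by (intro Bochner_Integration.integral_cong) (auto simp: indicator_def)
  \<comment> \<open>\<open>d\<close> is the inflow integral; the domain contributes its negative,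
    which cancels the boundary data. \<open>p\<close> and \<open>q\<close> are the wall integrals
    against \<open>dx \<phi>\<close> and \<open>dy \<phi>\<close>, and \<open>W\<close> is the force
    of the wall. In the first two lines \<open>i\<close> and \<open>c\<close>, respectively, stand
    for the flux from the domain into the wall.\<close>
  have balance: "p + q = - i \<Longrightarrow> 1 * (i - d) + p + (0 * e + q) + d = 0"
    "i = c - w \<Longrightarrow> W = - w \<Longrightarrow> p + q = - i \<Longrightarrow> 1 * (c - d) + p + (0 * e + q) + W + d = 0"
    "W = i \<Longrightarrow> p + q = - i \<Longrightarrow> 0 * f + p + (0 * e + q) + W = 0"
    for p q i d e c w W f :: real by auto
  show ?mass
  proof -
    have "(LINT x:{0..T}|lborel. b x * dx \<phi> (x, b x)) +
        (LINT x:{0..T}|lborel. deriv b x * b x * dy \<phi> (x, b x)) = - ?I (deriv b)"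
      by (intro parts continuous_b b_nonpos order_refl b_deriv I_slope)
    then show ?thesis unfolding mU mV X by (rule balance(1))
  qed
  have "?I (\<lambda>x. deriv b x - weight x * deriv b x) = ?I (deriv b) - ?I (\<lambda>x. weight x * deriv b x)"
    using set_integral_diff(2)[OF set_integrable_mult_loc_bounded[OF I_slope \<phi>_graph]
        set_integrable_mult_loc_bounded[OF I_weight_slope \<phi>_graph]]
    by (simp only: left_diff_distrib)
  \<comment> \<open>The arc length factor cancels the normalization of the unit normal, leaving
    \<open>weight x\<close> times (-b', 1).\<close>
  moreover have "wall_pairing b (\<lambda>x. weight x * normal1 b x) \<phi> = - ?I (\<lambda>x. weight x * deriv b x)"
  proof -
    have "weight x * normal1 b x * speed x = - (weight x * deriv b x)" for x
      using speed_pos[of x] by (simp add: normal1_def)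
    then show ?thesis unfolding wall by (simp only: mult_minus_left set_lebesgue_integral_def scaleR_minus_right
          Bochner_Integration.integral_minus)
  qed
  moreover have "(LINT x:{0..T}|lborel. K x * dx \<phi> (x, b x)) +
      (LINT x:{0..T}|lborel. deriv b x * K x * dy \<phi> (x, b x)) = - ?I (\<lambda>x. deriv b x - weight x * deriv b x)"
    by (intro parts continuous_K K_deriv set_integral_diff(1)[OF I_slope I_weight_slope]) (simp_all add: H_nonpos)
  ultimately show ?mom1 unfolding mUU mVU X by (intro balance(2))
  have "wall_pairing b (\<lambda>x. weight x * normal2 b x) \<phi> = ?I weight"
  proof -
    have "weight x * normal2 b x * speed x = weight x" for x
      using speed_pos[of x] by (simp add: normal2_def)
    then show ?thesis unfolding wall by (simp only:)
  qed
  moreover have "(LINT x:{0..T}|lborel. G x * dx \<phi> (x, b x)) +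
      (LINT x:{0..T}|lborel. deriv b x * G x * dy \<phi> (x, b x)) = - ?I weight"
    by (intro parts continuous_G G_deriv weight_integrable) (simp_all add: H_nonpos)
  ultimately show ?mom2 unfolding mUV mVV by (intro balance(3))
qed

text \<open>An open set that meets the closure of the domain meets the domain itself in a nonempty
  open set, which has positive area. Points of the wall are thus never in the vacuum, not even the
  corner, where the wall density is 0.\<close>

lemma vacuum_R:
  assumes N: "open N" "emeasure R N = 0" "z \<in> N"
  shows "z \<notin> \<Omega> \<union> W"
proof
  assume "z \<in> \<Omega> \<union> W"
  then have "z \<in> closure \<Omega>" using wall_subset_closure closure_subset by auto
  then have "\<Omega> \<inter> N \<noteq> {}" using N open_Int_closure_eq_empty[of N \<Omega>] by auto
  moreover have "open (\<Omega> \<inter> N)" using N open_domain by auto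
  ultimately have "\<not> negligible (\<Omega> \<inter> N)" by (rule open_not_negligible[rotated])
  moreover have "emeasure lborel (\<Omega> \<inter> N) = 0" using N by (simp add: emeasure_R)
  then have "\<Omega> \<inter> N \<in> null_sets lebesgue"
    using N open_domain by (intro null_sets_completionI) (simp add: null_sets_def)
  ultimately show False by (simp add: negligible_iff_null_sets)
qed

text \<open>An interior point of \<open>A\<close> has a ball around it inside the domain. There
  \<open>\<rho>\<close>, an arbitrary version of the density, equals 1 almost everywhere, and
  \<open>U\<close>, \<open>V\<close>, \<open>E\<close> are constant; so the limits from the two
  sides agree, contrary to the assumed jump.\<close>

lemma entropy_R:
  assumes A: "A \<subseteq> closure \<Omega>" and \<rho>: "is_RN_deriv_on A \<rho> (signed_of R) (signed_of lborel)"
    and E: "\<And>z. z \<in> \<Omega> \<Longrightarrow> E z = E0"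
  shows "entropy_condition_on A \<rho> U V E"
  unfolding entropy_condition_on_def
proof (intro ballI allI impI, elim conjE)
  fix z \<nu> \<rho>\<^sub>1 u\<^sub>1 v\<^sub>1 E\<^sub>1 \<rho>\<^sub>2 u\<^sub>2 v\<^sub>2 E\<^sub>2
  assume z: "z \<in> interior A" and \<nu>: "norm \<nu> = 1" 
    and lim: "one_sided_limit \<rho> z (- \<nu>) \<rho>\<^sub>1" "one_sided_limit \<rho> z \<nu> \<rho>\<^sub>2"
      "one_sided_limit U z (- \<nu>) u\<^sub>1" "one_sided_limit U z \<nu> u\<^sub>2"
      "one_sided_limit V z (- \<nu>) v\<^sub>1" "one_sided_limit V z \<nu> v\<^sub>2"
      "one_sided_limit E z (- \<nu>) E\<^sub>1" "one_sided_limit E z \<nu> E\<^sub>2"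
    and ne: "(\<rho>\<^sub>1, u\<^sub>1, v\<^sub>1, E\<^sub>1) \<noteq> (\<rho>\<^sub>2, u\<^sub>2, v\<^sub>2, E\<^sub>2)"
  obtain e where e: "0 < e" "ball z e \<subseteq> interior A"
    using z open_interior open_contains_ball by blast
  have sub: "ball z e \<subseteq> A" "ball z e \<subseteq> \<Omega>"
    using e(2) interior_subset[of A] interior_mono[OF A] interior_closure_domain by auto
  have one: "is_RN_deriv_on (ball z e) (\<lambda>_. 1) (signed_of R) (signed_of lborel)"
    unfolding is_RN_deriv_on_def
  proof (intro ballI impI)
    fix B :: "plane set" assume B: "B \<in> sets borel" "bounded B \<and> B \<subseteq> ball z e"
    then have "\<Omega> \<inter> B = B" "B \<inter> W = {}" using sub(2) by (auto simp: ramp_domain_def ramp_wall_def)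
    then have "emeasure R B = emeasure lborel B" using B by (simp add: emeasure_R wall_null)
    moreover have "emeasure lborel B < \<infinity>" using B radon_measure_bounded[OF radon_lborel] by blast
    ultimately show "set_integrable (fst (signed_of lborel)) B (\<lambda>_. 1 :: real) \<and>
        set_integrable (snd (signed_of lborel)) B (\<lambda>_. 1 :: real) \<and>
        measure (fst (signed_of R)) B - measure (snd (signed_of R)) B =
          (LINT z:B|fst (signed_of lborel). 1) - (LINT z:B|snd (signed_of lborel). 1)"
      using B by (simp add: set_integrable_def set_lebesgue_integral_def measure_def
          measurable_cong_sets[OF sets_null_measure refl])
  qed
  have \<rho>1: "AE w in lborel. w \<in> ball z e \<longrightarrow> \<rho> w = 1"
    using is_RN_deriv_on_lborel_unique[OF is_RN_deriv_on_subset[OF \<rho> sub(1)] one] by simp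
  have const: "AE w in lborel. w \<in> ball z e \<longrightarrow> U w = 1" "AE w in lborel. w \<in> ball z e \<longrightarrow> V w = 0"
    "AE w in lborel. w \<in> ball z e \<longrightarrow> E w = E0"
    using subsetD[OF sub(2)] by (blast intro: AE_I2 U_domain V_domain E)+
  have \<nu>': "norm (- \<nu>) = 1" using \<nu> by simp
  note unique = one_sided_limit_const[OF _ \<nu> e(1)] one_sided_limit_const[OF _ \<nu>' e(1)]
  have "\<rho>\<^sub>1 = \<rho>\<^sub>2" "u\<^sub>1 = u\<^sub>2" "v\<^sub>1 = v\<^sub>2" "E\<^sub>1 = E\<^sub>2"
    using unique(2)[OF lim(1) \<rho>1] unique(1)[OF lim(2) \<rho>1]
      unique(2)[OF lim(3) const(1)] unique(1)[OF lim(4) const(1)]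
      unique(2)[OF lim(5) const(2)] unique(1)[OF lim(6) const(2)]
      unique(2)[OF lim(7) const(3)] unique(1)[OF lim(8) const(3)] by simp_all
  with ne show "\<rho>\<^sub>1 < \<rho>\<^sub>2" by simp
qed

theorem measure_solution_ramp:
  assumes "0 \<le> E0"
  shows "measure_solution 1 b 1 1 0 E0 R U V
    (\<lambda>(x, y). E0 * indicator \<Omega> (x, y) + E0 * indicator W (x, y)) weight"
proof -
  define E where "E = (\<lambda>(x, y). E0 * indicator \<Omega> (x, y) + E0 * indicator W (x, y))"
  have disj: "z \<notin> W" if "z \<in> \<Omega>" for z using that by (auto simp: ramp_domain_def ramp_wall_def)
  have E_eq: "E z = (if z \<in> \<Omega> \<union> W then E0 else 0)" for z
    using disj[of z] by (cases z) (auto simp: E_def indicator_def)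
  have borel_E: "E \<in> borel_measurable borel"
    unfolding E_eq[abs_def] by measurable
  \<comment> \<open>\<open>E\<close> equals \<open>E0\<close> wherever \<open>U\<close> or
    \<open>V\<close> is nonzero. The energy balance is therefore \<open>E0\<close> times the mass
    balance.\<close>
  have UE: "U z * E z = U z * E0" "V z * E z = V z * E0" for z
  proof -
    have "U z * E z = U z * E0 \<and> V z * E z = V z * E0"
    proof (cases "z \<in> \<Omega> \<union> W")
      case True
      then show ?thesis by (simp only: E_eq if_True)
    next
      case False
      then have "U z = 0" "V z = 0" using U_outside V_outside by blast+
      then show ?thesis by (simp only: mult_zero_left)
    qed
    then show "U z * E z = U z * E0" "V z * E z = V z * E0" by blast+
  qed
  have "measure_solution 1 b 1 1 0 E0 R U V E weight"
  proof (rule measure_solution_pressurelessI[OF radon_R concentrated_R borel_U U_bounds borel_V V_bounds borel_E])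
    show "0 \<le> E z" "E z \<le> E0" for z using assms by (auto simp: E_eq)
    show "0 \<le> weight x" if "0 \<le> x" for x using that by (rule weight_nonneg)
    show "set_integrable lborel {0..T} weight" for T by (rule weight_integrable)
    fix \<phi> assume \<phi>: "C1_compact_support \<phi>"
    note weak = weak_formulation[OF \<phi>]
    show "(\<integral>z. U z * dx \<phi> z \<partial>R) + (\<integral>z. V z * dy \<phi> z \<partial>R) + (LINT y:{0..}|lborel. 1 * 1 * \<phi> (0, y)) = 0"
      using weak(1) by (simp only: mult_1)
    show "(\<integral>z. U z * U z * dx \<phi> z \<partial>R) + (\<integral>z. V z * U z * dy \<phi> z \<partial>R)
        + wall_pairing b (\<lambda>x. weight x * normal1 b x) \<phi> + (LINT y:{0..}|lborel. 1 * 1\<^sup>2 * \<phi> (0, y)) = 0"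
      using weak(2) by (simp only: mult_1 one_power2)
    show "(\<integral>z. U z * V z * dx \<phi> z \<partial>R) + (\<integral>z. V z * V z * dy \<phi> z \<partial>R)
        + wall_pairing b (\<lambda>x. weight x * normal2 b x) \<phi> + (LINT y:{0..}|lborel. 1 * 1 * 0 * \<phi> (0, y)) = 0"
    proof -
      have "(LINT y:{0..}|lborel. 1 * 1 * 0 * \<phi> (0, y)) = 0" by (simp add: set_lebesgue_integral_def)
      then show ?thesis using weak(3) by linarith
    qed
    show "(\<integral>z. U z * E z * dx \<phi> z \<partial>R) + (\<integral>z. V z * E z * dy \<phi> z \<partial>R)
        + (LINT y:{0..}|lborel. 1 * 1 * E0 * \<phi> (0, y)) = 0"
    proof -
      have *: "U z * E0 * c = E0 * (U z * c)" "V z * E0 * c = E0 * (V z * c)" for z c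
        by (simp_all only: mult_ac)
      have "(\<integral>z. U z * E z * dx \<phi> z \<partial>R) + (\<integral>z. V z * E z * dy \<phi> z \<partial>R)
          + (LINT y:{0..}|lborel. 1 * 1 * E0 * \<phi> (0, y)) =
        E0 * ((\<integral>z. U z * dx \<phi> z \<partial>R) + (\<integral>z. V z * dy \<phi> z \<partial>R) + (LINT y:{0..}|lborel. \<phi> (0, y)))"
        unfolding UE * by (simp only: mult_1 integral_mult_right_zero set_integral_mult_right distrib_left)
      then show ?thesis unfolding weak(1) by simp
    qed
  next
    fix N z assume "open N" "emeasure R N = 0" "z \<in> N"
    then have "z \<notin> \<Omega>" "z \<notin> W" using vacuum_R by auto
    then show "U z = 0 \<and> V z = 0 \<and> E z = 0"
      using U_outside V_outside by (simp add: E_eq)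
  next
    fix A \<rho> assume "A \<subseteq> closure \<Omega>" "is_RN_deriv_on A \<rho> (signed_of R) (signed_of lborel)"
    then show "entropy_condition_on A \<rho> U V E" by (rule entropy_R) (simp add: E_eq)
  qed
  then show ?thesis unfolding E_def .
qed

end

theorem theorem1p1:
  fixes b :: "real \<Rightarrow> real" and E0 :: real
  assumes "continuous_on UNIV b"
    and "\<And>x. x \<le> 0 \<Longrightarrow> b x = 0"
    and "C2_on {0<..} b"
    and "\<And>T. \<exists>L. L-lipschitz_on {0..T} b"
    and "\<And>x. x > 0 \<Longrightarrow> deriv b x \<ge> 0"
    and "\<And>x. x > 0 \<Longrightarrow>
      deriv (deriv b) x * ramp_H b x > - ((deriv b x)\<^sup>2 * sqrt (1 + (deriv b x)\<^sup>2))"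
    and "E0 > 1 / 2"
  shows "measure_solution 1 b 1 1 0 E0
    (add_measure
      (density lborel (indicator (ramp_domain b)))
      (wall_dirac b (\<lambda>x. (b x)\<^sup>2 / ramp_H b x)))
    (\<lambda>(x, y). indicator (ramp_domain b) (x, y)
      + ramp_H b x / (b x * sqrt (1 + (deriv b x)\<^sup>2)) * indicator (ramp_wall b) (x, y))
    (\<lambda>(x, y). deriv b x * ramp_H b x / (b x * sqrt (1 + (deriv b x)\<^sup>2))
      * indicator (ramp_wall b) (x, y))
    (\<lambda>(x, y). E0 * indicator (ramp_domain b) (x, y) + E0 * indicator (ramp_wall b) (x, y))
    (\<lambda>x. (deriv (deriv b) x * ramp_H b x + (deriv b x)\<^sup>2 * sqrt (1 + (deriv b x)\<^sup>2))
      / (1 + (deriv b x)\<^sup>2) powr (3 / 2))"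
proof -
  interpret ramp b by unfold_locales (fact assms)+
  show ?thesis using assms(7) by (intro measure_solution_ramp) simp
qed

end
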